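(* Let $E$ and $F$ be two staircases included in a box $B_{M\times N}$, and let $E^{\nu}$ and $F^{\nu}$ be their respective duals in $B_{M\times N}$. If $\overline{C(E)}\cap C(F)\neq\emptyset$, then: 1. there exists a system of arrows $S$ on $E$ such that $S(E)=F$; 2. there exists a system of arrows $S^{\nu}$ on $E^{\nu}$ such that $S^{\nu}(E^{\nu})=F^{\nu}$.
   Context: Let $k$ be an algebraically closed field and let $a,b$ be relatively prime integers with $a>0$ and $b\neq 0$. Let $\mathbb{H}$ be the Hilbert scheme parametrizing the zero-dimensional subschemes of $\operatorname{Spec} k[x,y]$ (all lengths). The torus $k^*\times k^*$ acts on $\mathbb{H}$ via $(t_1,t_2).x^{\alpha}y^{\beta}=(t_1x)^{\alpha}(t_2y)^{\beta}$. Let $T_{ab}=\{(t^{-b},t^{a}),\ t\in k^*\}$ and let $\mathbb{H}_{ab}\subset\mathbb{H}$ be the closed subscheme parametrizing the $T_{ab}$-invariant subschemes. Put $d(x^{\alpha}y^{\beta})=-b\alpha+a\beta$ and $d_y(x^{\alpha}y^{\beta})=\beta$. Let $k[x,y]_n$ be the span of the monomials $m$ with $d(m)=n$, and $I_n=I\cap k[x,y]_n$ for an ideal $I$. Then $Z\in\mathbb{H}_{ab}$ iff its ideal satisfies $I(Z)=\bigoplus_n I(Z)_n$. The Hilbert function of $Z\in\mathbb{H}_{ab}$ is $H(Z)=(h_n)_n$, $h_n=\operatorname{codim}(I(Z)_n\subset k[x,y]_n)$, and $\mathbb{H}_{ab}(H)$ is the closed subscheme of $\mathbb H$ parametrizing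 the $Z\in\mathbb{H}_{ab}$ with $H(Z)=H$. Monomials are ordered by: $m_1<m_2$ if $d(m_1)<d(m_2)$, or $d(m_1)=d(m_2)$ and $d_y(m_1)<d_y(m_2)$. Monomials $x^py^q$ are identified with couples $(p,q)\in\mathbb{N}^2$. A staircase is a subset of $\mathbb{N}^2$ whose complement is stable under addition of elements of $\mathbb{N}^2$. For a staircase $E$, $I^E$ is the ideal generated by the monomials not in $E$; for $E$ finite, $Z(E)$ is the subscheme with ideal $I^E$. For a finite staircase $E$, the Schubert cell $C(E)$ is the locus in $\mathbb{H}_{ab}(H)$, $H=H(Z(E))$, of the subschemes whose ideal has initial ideal $I^E$: if $m_1,m_2,\dots$ are the monomials not in $E$, the ideal has a $k$-basis $f_1,f_2,\dots$ with $f_i=m_i+R_i$, $R_i$ a linear combination of monomials strictly smaller than $m_i$. $\overline{C(E)}$ is the closure of $C(E)$ in $\mathbb{H}_{ab}(H)$. An arrow on a staircase $E$ is a couple $(P,Q)$ of monomials (origin $P$, end $Q$) with $P\in E$ and $\overrightarrow{PQ}=Q-P$ a negative multiple of $(a,b)$, the zero multiple being allowed (so $(P,P)$ is an arrow). An arrow $(P,Q)$ with $\overrightarrow{PQ}=\lambda(a,b)$ is shorter than $(P',Q')$ with $\overrightarrow{P'Q'}=\lambda'(a,b)$ if $|\lambda|\le|\lambda'|$. A system of arrows on $E$ is a set $S=\{(p,f_p):p\in E\}$ consisting of one arrow $(p,f_p)$ on $E$ for each $p\in E$, such that: (i) $p\neq q\Rightarrow f_p\neq f_q$; (ii) (compatibility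 with division) for every $f=(P,Q)\in S$ and every monomial $Q'$ dividing $Q$, there is $g\in S$ with end $Q'$ that is shorter than $f$. $S(E)$ denotes the set of ends of the arrows of $S$. The box is $B_{M\times N}=\{(x,y)\in\mathbb{N}^2: x<M,\ y<N\}$. The dual of a staircase $E\subset B_{M\times N}$ is the staircase $E^{\nu}=E^{\nu}_{MN}=\{(x,y)\in B_{M\times N}: (M-1-x,\,N-1-y)\notin E\}$. *)

theory Defs
  imports
    "HOL-Analysis.Analysis"
    "HOL-Library.Poly_Mapping"
    "HOL-Computational_Algebra.Polynomial"
begin

text \<open>
  Monomials \<open>x^p y^q\<close> are pairs \<open>(p, q)\<close>, and \<open>k[x,y]\<close> is the monoid algebra of \<open>\<nat>\<^sup>2\<close>, with the
  ring structure provided by \<^theory>\<open>HOL-Library.Poly_Mapping\<close>.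
\<close>

type_synonym monomial = "nat \<times> nat"
type_synonym 'k bipoly = "monomial \<Rightarrow>\<^sub>0 'k"

abbreviation mon :: "monomial \<Rightarrow> 'k::field bipoly"
  where "mon m \<equiv> Poly_Mapping.single m 1"

definition scale :: "'k::field \<Rightarrow> 'k bipoly \<Rightarrow> 'k bipoly"
  where "scale c f = Poly_Mapping.single 0 c * f"

text \<open>
  \<open>pmod.subspace I\<close> says that \<open>I\<close> is an ideal of \<open>k[x,y]\<close>, and \<open>pmod.span X\<close> is the ideal generated
  by \<open>X\<close>; \<open>kvec.subspace\<close> and \<open>kvec.span\<close> are the corresponding notions for \<open>k\<close>-vector spaces.
\<close>

interpretation pmod: module "(*) :: 'k::field bipoly \<Rightarrow> 'k bipoly \<Rightarrow> 'k bipoly"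
  by unfold_locales (simp_all add: algebra_simps)

interpretation kvec: vector_space "scale :: 'k::field \<Rightarrow> 'k bipoly \<Rightarrow> 'k bipoly"
proof unfold_locales
  fix c d :: 'k and f g :: "'k bipoly"
  show "scale c (f + g) = scale c f + scale c g"
    by (simp add: scale_def distrib_left)
  show "scale (c + d) f = scale c f + scale d f"
    by (simp add: scale_def single_add distrib_right)
  show "scale c (scale d f) = scale (c * d) f"
    by (simp add: scale_def mult.assoc[symmetric] mult_single)
  show "scale 1 f = f"
    by (simp add: scale_def)
qed


section \<open>Bases of quotients and codimension\<close>

text \<open>\<open>B\<close> is (a lift of) a \<open>k\<close>-basis of \<open>V / W\<close>, for subspaces \<open>W \<subseteq> V\<close>.\<close>

definition basis_mod :: "'k::field bipoly set \<Rightarrow> 'k bipoly set \<Rightarrow> 'k bipoly set \<Rightarrow> bool"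
  where "basis_mod W V B \<longleftrightarrow>
    B \<subseteq> V \<and> kvec.independent B \<and> kvec.span B \<inter> W = {0} \<and> V \<subseteq> kvec.span (B \<union> W)"

text \<open>Meaningful when the codimension is finite; otherwise 0.\<close>

definition codim :: "'k::field bipoly set \<Rightarrow> 'k bipoly set \<Rightarrow> nat"
  where "codim W V = card (SOME B. basis_mod W V B)"


section \<open>The Hilbert scheme and its Zariski topology\<close>

text \<open>
  The scheme is represented by its \<open>k\<close>-points: the zero-dimensional subschemes of the affine plane,
  that is, the ideals of finite colength.
\<close>

definition Hilb :: "'k::field bipoly set set"
  where "Hilb = {I. pmod.subspace I \<and> (\<exists>B. finite B \<and> basis_mod I UNIV B)}"

text \<open>
  The standard affine charts: \<open>chart B\<close> consists of the ideals \<open>I\<close> for which the monomials in \<open>B\<close>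
  form a basis of \<open>k[x,y] / I\<close>. On it, \<open>m \<equiv> (\<Sum>b\<in>B. coord B m b I \<cdot> b)\<close> modulo \<open>I\<close> for every
  monomial \<open>m\<close>, and the functions \<open>coord B m b\<close> generate the coordinate ring of the chart.
\<close>

definition chart :: "monomial set \<Rightarrow> 'k::field bipoly set set"
  where "chart B = {I \<in> Hilb. basis_mod I UNIV (mon ` B)}"

definition coord :: "monomial set \<Rightarrow> monomial \<Rightarrow> monomial \<Rightarrow> 'k::field bipoly set \<Rightarrow> 'k"
  where "coord B m b I =
    Poly_Mapping.lookup (THE r. Poly_Mapping.keys r \<subseteq> B \<and> mon m - r \<in> I) b"

inductive_set coord_ring :: "monomial set \<Rightarrow> ('k::field bipoly set \<Rightarrow> 'k) set"
  for B :: "monomial set"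
where
  const: "(\<lambda>I. c) \<in> coord_ring B"
| coord: "b \<in> B \<Longrightarrow> coord B m b \<in> coord_ring B"
| add: "\<phi> \<in> coord_ring B \<Longrightarrow> \<psi> \<in> coord_ring B \<Longrightarrow> (\<lambda>I. \<phi> I + \<psi> I) \<in> coord_ring B"
| mult: "\<phi> \<in> coord_ring B \<Longrightarrow> \<psi> \<in> coord_ring B \<Longrightarrow> (\<lambda>I. \<phi> I * \<psi> I) \<in> coord_ring B"

text \<open>The distinguished open subsets of the charts form a basis of the Zariski topology.\<close>

definition hilb_topology :: "'k::field bipoly set topology"
  where "hilb_topology =
    topology_generated_by {{I \<in> chart B. \<phi> I \<noteq> 0} | B \<phi>. \<phi> \<in> coord_ring B}"

lemma span_mon_UNIV: "kvec.span (range mon) = (UNIV :: 'k::field bipoly set)"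
proof -
  have "f \<in> kvec.span (range mon)" for f :: "'k bipoly"
  proof -
    have "Poly_Mapping.single m c = scale c (mon m)" for m and c :: 'k
      by (simp add: scale_def mult_single)
    then have "Poly_Mapping.single m c \<in> kvec.span (range mon)" for m and c :: 'k
      by (metis kvec.span_base kvec.span_scale rangeI)
    then have "(\<Sum>m\<in>Poly_Mapping.keys f. Poly_Mapping.single m (Poly_Mapping.lookup f m))
        \<in> kvec.span (range mon)"
      by (intro kvec.span_sum)
    moreover have "(\<Sum>m\<in>Poly_Mapping.keys f. Poly_Mapping.single m (Poly_Mapping.lookup f m)) = f"
      by (rule poly_mapping_eqI)
        (auto simp: lookup_sum lookup_single when_def in_keys_iff)
    ultimately show ?thesis
      by simp
  qed
  then show ?thesis by blast
qed

lemma ideal_imp_kvec_subspace: "pmod.subspace I \<Longrightarrow> kvec.subspace I"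
  by (auto simp: pmod.subspace_def kvec.subspace_def scale_def)

lemma ex_monomial_basis:
  fixes I :: "'k::field bipoly set"
  assumes "kvec.subspace I"
  shows "\<exists>B. basis_mod I UNIV (mon ` B)"
proof -
  obtain S where S: "S \<subseteq> I" "kvec.independent S" "I \<subseteq> kvec.span S"
    by (rule kvec.maximal_independent_subset)
  have spS: "kvec.span S = I"
    by (rule antisym[OF kvec.span_minimal[OF S(1) assms] S(3)])
  obtain T where T: "S \<subseteq> T" "T \<subseteq> S \<union> range mon" "kvec.independent T"
      "S \<union> range mon \<subseteq> kvec.span T"
    by (rule kvec.maximal_independent_subset_extend[OF Un_upper1 S(2)])
  have "range mon \<subseteq> kvec.span T"
    using T(4) by simp
  then have spT: "kvec.span T = UNIV"
    using kvec.span_minimal[OF _ kvec.subspace_span] span_mon_UNIV by (metis top.extremum_uniqueI)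
  have "T - S \<subseteq> range mon"
    using T(2) by blast
  then obtain B where B: "T - S = mon ` B"
    by (rule subset_imageE)
  have "f = 0" if f: "f \<in> kvec.span (T - S)" "f \<in> kvec.span S" for f
  proof -
    have 1: "kvec.representation T f = kvec.representation (T - S) f"
      by (rule kvec.representation_extend[OF T(3) f(1)]) simp
    have 2: "kvec.representation T f = kvec.representation S f"
      by (rule kvec.representation_extend[OF T(3) f(2) T(1)])
    have "kvec.representation T f v = 0" for v
      using kvec.representation_ne_zero[of "T - S" f v] kvec.representation_ne_zero[of S f v] 1 2
      by auto
    then show "f = 0"
      using kvec.sum_nonzero_representation_eq[OF T(3), of f] spT by simp
  qed
  then have "kvec.span (T - S) \<inter> I = {0}"
    using kvec.span_zero spS by blast
  moreover have "kvec.independent (T - S)"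
    by (rule kvec.independent_mono[OF T(3)]) simp
  moreover have "UNIV \<subseteq> kvec.span ((T - S) \<union> I)"
  proof -
    have "T \<subseteq> (T - S) \<union> I"
      using S(1) by blast
    then show ?thesis
      using kvec.span_mono spT by metis
  qed
  ultimately have "basis_mod I UNIV (T - S)"
    unfolding basis_mod_def by simp
  then show ?thesis
    unfolding B by blast
qed

lemma topspace_hilb_topology: "topspace hilb_topology = (Hilb :: 'k::field bipoly set set)"
proof
  show "topspace hilb_topology \<subseteq> (Hilb :: 'k bipoly set set)"
    unfolding hilb_topology_def topology_generated_by_topspace by (auto simp: chart_def)
  show "(Hilb :: 'k bipoly set set) \<subseteq> topspace hilb_topology"
  proof
    fix I :: "'k bipoly set"
    assume I: "I \<in> Hilb"
    then have "kvec.subspace I"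
      by (intro ideal_imp_kvec_subspace) (simp add: Hilb_def)
    then obtain B where "basis_mod I UNIV (mon ` B)"
      using ex_monomial_basis by blast
    then have "I \<in> {I \<in> chart B. (1 :: 'k) \<noteq> 0}"
      using I by (simp add: chart_def)
    moreover have "{I \<in> chart B. (1 :: 'k) \<noteq> 0} \<in>
        {{I \<in> chart B. \<phi> I \<noteq> 0} | B \<phi>. \<phi> \<in> (coord_ring B :: ('k bipoly set \<Rightarrow> 'k) set)}"
      proof (intro CollectI exI conjI)
      show "(\<lambda>_. 1) \<in> (coord_ring B :: ('k bipoly set \<Rightarrow> 'k) set)"
        by (rule coord_ring.const)
    qed (rule refl)
    ultimately show "I \<in> topspace hilb_topology"
      unfolding hilb_topology_def topology_generated_by_topspace by (rule UnionI[rotated])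
  qed
qed


section \<open>The torus action and equivariant Hilbert schemes\<close>

definition torus_act :: "'k::field \<Rightarrow> 'k \<Rightarrow> 'k bipoly \<Rightarrow> 'k bipoly"
  where "torus_act t\<^sub>1 t\<^sub>2 = Poly_Mapping.mapp (\<lambda>(\<alpha>, \<beta>) c. t\<^sub>1 ^ \<alpha> * t\<^sub>2 ^ \<beta> * c)"

definition Hilb_inv :: "int \<Rightarrow> int \<Rightarrow> 'k::field bipoly set set"
  where "Hilb_inv a b =
    {I \<in> Hilb. \<forall>t. t \<noteq> 0 \<longrightarrow> torus_act (t powi (- b)) (t powi a) ` I = I}"

fun wdeg :: "int \<Rightarrow> int \<Rightarrow> monomial \<Rightarrow> int"
  where "wdeg a b (\<alpha>, \<beta>) = - b * int \<alpha> + a * int \<beta>"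

definition graded_part :: "int \<Rightarrow> int \<Rightarrow> int \<Rightarrow> 'k::field bipoly set"
  where "graded_part a b n = kvec.span (mon ` {m. wdeg a b m = n})"

definition hilbert_fun :: "int \<Rightarrow> int \<Rightarrow> 'k::field bipoly set \<Rightarrow> int \<Rightarrow> nat"
  where "hilbert_fun a b I n = codim (I \<inter> graded_part a b n) (graded_part a b n)"

definition Hilb_H :: "int \<Rightarrow> int \<Rightarrow> (int \<Rightarrow> nat) \<Rightarrow> 'k::field bipoly set set"
  where "Hilb_H a b H = {I \<in> Hilb_inv a b. hilbert_fun a b I = H}"


section \<open>Staircases and Schubert cells\<close>

definition staircase :: "monomial set \<Rightarrow> bool"
  where "staircase E \<longleftrightarrow> (\<forall>m n. m \<notin> E \<longrightarrow> m + n \<notin> E)"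

definition staircase_ideal :: "monomial set \<Rightarrow> 'k::field bipoly set"
  where "staircase_ideal E = pmod.span (mon ` (- E))"

definition mon_less :: "int \<Rightarrow> int \<Rightarrow> monomial \<Rightarrow> monomial \<Rightarrow> bool"
  where "mon_less a b m\<^sub>1 m\<^sub>2 \<longleftrightarrow>
    wdeg a b m\<^sub>1 < wdeg a b m\<^sub>2 \<or> wdeg a b m\<^sub>1 = wdeg a b m\<^sub>2 \<and> snd m\<^sub>1 < snd m\<^sub>2"

definition initial_mon :: "int \<Rightarrow> int \<Rightarrow> 'k::field bipoly \<Rightarrow> monomial"
  where "initial_mon a b f =
    (THE m. m \<in> Poly_Mapping.keys f \<and> (\<forall>m'\<in>Poly_Mapping.keys f. m' \<noteq> m \<longrightarrow> mon_less a b m' m))"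

definition initial_ideal :: "int \<Rightarrow> int \<Rightarrow> 'k::field bipoly set \<Rightarrow> 'k bipoly set"
  where "initial_ideal a b I = pmod.span {mon (initial_mon a b f) | f. f \<in> I \<and> f \<noteq> 0}"

definition schubert_cell :: "int \<Rightarrow> int \<Rightarrow> monomial set \<Rightarrow> 'k::field bipoly set set"
  where "schubert_cell a b E =
    {I \<in> Hilb_H a b (hilbert_fun a b (staircase_ideal E :: 'k bipoly set)).
      initial_ideal a b I = staircase_ideal E}"

definition schubert_closure :: "int \<Rightarrow> int \<Rightarrow> monomial set \<Rightarrow> 'k::field bipoly set set"
  where "schubert_closure a b E =
    subtopology hilb_topology (Hilb_H a b (hilbert_fun a b (staircase_ideal E :: 'k bipoly set)))
      closure_of schubert_cell a b E"


section \<open>Systems of arrows\<close>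

type_synonym arrow = "monomial \<times> monomial"

text \<open>The vector from the origin to the end of the arrow is \<open>l \<cdot> (a, b)\<close>.\<close>

fun arrow_vec :: "int \<Rightarrow> int \<Rightarrow> arrow \<Rightarrow> int \<Rightarrow> bool"
  where "arrow_vec a b ((p\<^sub>1, p\<^sub>2), (q\<^sub>1, q\<^sub>2)) l \<longleftrightarrow>
    int q\<^sub>1 - int p\<^sub>1 = l * a \<and> int q\<^sub>2 - int p\<^sub>2 = l * b"

definition is_arrow :: "int \<Rightarrow> int \<Rightarrow> monomial set \<Rightarrow> arrow \<Rightarrow> bool"
  where "is_arrow a b E f \<longleftrightarrow> fst f \<in> E \<and> (\<exists>l\<le>0. arrow_vec a b f l)"

text \<open>In the sense of \<open>\<bar>l\<bar> \<le> \<bar>l'\<bar>\<close>: an arrow is shorter than itself.\<close>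

definition shorter :: "int \<Rightarrow> int \<Rightarrow> arrow \<Rightarrow> arrow \<Rightarrow> bool"
  where "shorter a b f f' \<longleftrightarrow>
    (\<exists>l l'. arrow_vec a b f l \<and> arrow_vec a b f' l' \<and> \<bar>l\<bar> \<le> \<bar>l'\<bar>)"

definition mon_dvd :: "monomial \<Rightarrow> monomial \<Rightarrow> bool"
  where "mon_dvd m n \<longleftrightarrow> (\<exists>m'. n = m + m')"

definition arrow_system :: "int \<Rightarrow> int \<Rightarrow> monomial set \<Rightarrow> arrow set \<Rightarrow> bool"
  where "arrow_system a b E S \<longleftrightarrow>
    (\<exists>e. S = {(p, e p) | p. p \<in> E} \<and> (\<forall>p\<in>E. is_arrow a b E (p, e p)) \<and> inj_on e E) \<and>
    (\<forall>f\<in>S. \<forall>Q'. mon_dvd Q' (snd f) \<longrightarrow> (\<exists>g\<in>S. snd g = Q' \<and> shorter a b g f))"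

definition arrow_ends :: "arrow set \<Rightarrow> monomial set"
  where "arrow_ends S = snd ` S"


section \<open>Boxes and duality\<close>

definition staircase_box :: "nat \<Rightarrow> nat \<Rightarrow> monomial set"
  where "staircase_box M N = {..<M} \<times> {..<N}"

definition dual_staircase :: "nat \<Rightarrow> nat \<Rightarrow> monomial set \<Rightarrow> monomial set"
  where "dual_staircase M N E = {(x, y) \<in> staircase_box M N. (M - 1 - x, N - 1 - y) \<notin> E}"

end

theory Submission
  imports Defs "HOL-Library.Function_Algebras"
begin

text \<open>
  Let \<open>I0\<close> be a point of the cell of \<open>F\<close> in the closure of the cell of \<open>E\<close>. Ideals fixed by the torus are
  homogeneous for the weight \<open>d\<close>, so that they can be studied on each line of monomials of a given weight.

  If \<open>b > 0\<close>, then both exponents grow along a line, and since some power of \<open>x\<close> belongs to each ideal of the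
  cell of \<open>E\<close>, such an ideal is generated by monomials (\<open>positive_slope_monomial\<close>). Near \<open>I0\<close> the monomials in
  \<open>F\<close> are a basis of the quotient, which forces \<open>E = F\<close>, and the arrows \<open>(p, p)\<close> do.

  If \<open>b < 0\<close>, then the lines are finite, and height, that is the second exponent, orders each of them. Let
  \<open>R(n, c)\<close> be spanned by the monomials of weight \<open>n\<close> and height less than \<open>c\<close>. For an ideal \<open>I\<close> of the cell of
  \<open>E\<close>, the dimensions of \<open>I(n) + R(n, c)\<close> and \<open>I(n) \<inter> R(n, c)\<close> increase by one in the step from \<open>c\<close> to \<open>c + 1\<close>
  exactly when the monomial of weight \<open>n\<close> and height \<open>c\<close> exists and lies in \<open>E\<close>, or outside \<open>E\<close>, respectively.
  Moreover, multiplication by a monomial \<open>m\<close> maps the spaces with parameters \<open>(n, c)\<close> to those with parameters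
  \<open>(n + d(m), c + d\<^sub>y(m))\<close>. Now let \<open>I\<close> tend to \<open>I0\<close>. The limits of these spaces have the same
  dimensions (\<open>card_limit_monomials\<close>), they inherit the inclusions and the multiplications, and the limit
  of \<open>I(n)\<close> is \<open>I0(n)\<close>, whose leading monomials are those outside \<open>F\<close> (\<open>limit_homog_part\<close>). So the sets of
  leading monomials of the limits form chains, from the complement of \<open>F\<close> to everything in the first case, and
  from nothing to the complement of \<open>F\<close> in the second. Matching the monomial that enters in step \<open>c\<close> with the one
  of height \<open>c\<close> (\<open>jump_bijection\<close>) gives bijections \<open>F \<rightarrow> E\<close> and \<open>-F \<rightarrow> -E\<close> along the lines. The first one lowers
  heights and the second one raises them. If \<open>Q\<close> enters in step \<open>c\<close>, then \<open>m + Q\<close> has entered by step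
  \<open>c + d\<^sub>y(m)\<close>. In the first case this is the compatibility of the arrows on \<open>E\<close> with division. In the
  second case it becomes the same compatibility on the dual staircase after the reflection of the box, which
  reverses divisibility.

  Limits of spaces are taken along a valuation dominating the local ring of the closure at \<open>I0\<close>. It lives on the
  ring of all functions on the cell, which is not a field, and so it is a Manis valuation
  (\<open>ex_manis_pair\<close>). It rescales a vector of functions without common zeros so that its entries stay
  finite and do not all tend to 0 (\<open>ex_normalising_factor\<close>); this is what a curve through \<open>I0\<close>, or the
  properness of flag varieties, would provide.
\<close>

section \<open>Dominating pairs of a ring and an ideal\<close>

text \<open>
  A subring \<open>V\<close> of an arbitrary commutative ring and a proper ideal \<open>P\<close> of \<open>V\<close>. Such pairs are compared by
  inclusion in both components; the maximal ones play the role of valuation rings.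
\<close>

locale ring_with_ideal =
  fixes V P :: "'r::comm_ring_1 set"
  assumes one_V: "1 \<in> V"
    and add_V: "x \<in> V \<Longrightarrow> y \<in> V \<Longrightarrow> x + y \<in> V"
    and uminus_V: "x \<in> V \<Longrightarrow> - x \<in> V"
    and mult_V: "x \<in> V \<Longrightarrow> y \<in> V \<Longrightarrow> x * y \<in> V"
    and P_subset_V: "P \<subseteq> V"
    and zero_P: "0 \<in> P"
    and add_P: "x \<in> P \<Longrightarrow> y \<in> P \<Longrightarrow> x + y \<in> P"
    and mult_P: "x \<in> V \<Longrightarrow> y \<in> P \<Longrightarrow> x * y \<in> P"
    and one_notin_P: "1 \<notin> P"
begin

lemma uminus_P: "x \<in> P \<Longrightarrow> - x \<in> P"
  using mult_P[OF uminus_V[OF one_V]] by simp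

lemma diff_P: "x \<in> P \<Longrightarrow> y \<in> P \<Longrightarrow> x - y \<in> P"
  using add_P[OF _ uminus_P] by simp

lemma diff_V: "x \<in> V \<Longrightarrow> y \<in> V \<Longrightarrow> x - y \<in> V"
  using add_V[OF _ uminus_V] by simp

lemma mult_P': "x \<in> P \<Longrightarrow> y \<in> V \<Longrightarrow> x * y \<in> P"
  using mult_P[of y x] by (simp add: mult.commute)

lemma one_minus_notin_P: "p \<in> P \<Longrightarrow> 1 - p \<notin> P"
  using add_P one_notin_P by force

lemma one_minus_V: "p \<in> P \<Longrightarrow> 1 - p \<in> V"
  using diff_V one_V P_subset_V by blast

lemma sum_P: "(\<And>j. j \<in> J \<Longrightarrow> f j \<in> P) \<Longrightarrow> sum f J \<in> P"
  by (induction J rule: infinite_finite_induct) (auto intro: add_P zero_P)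

text \<open>
  The values at \<open>x\<close> of the polynomials of degree at most \<open>n\<close> with coefficients in \<open>P\<close>, in Horner form.
\<close>

primrec polys :: "'r \<Rightarrow> nat \<Rightarrow> 'r set"
  where
    "polys x 0 = P"
  | "polys x (Suc n) = {p + x * f | p f. p \<in> P \<and> f \<in> polys x n}"

lemma P_subset_polys: "P \<subseteq> polys x n"
proof (induction n)
  case (Suc n)
  have "p = p + x * 0" for p
    by simp
  then show ?case
    using zero_P Suc unfolding polys.simps by blast
qed simp

lemma polys_mono_Suc: "polys x n \<subseteq> polys x (Suc n)"
proof (induction n)
  case 0
  then show ?case using P_subset_polys[of x "Suc 0"] by simp
next
  case (Suc n)
  then show ?case
    unfolding polys.simps(2)[of x n] polys.simps(2)[of x "Suc n"] by blast
qed

lemma polys_mono: "m \<le> n \<Longrightarrow> polys x m \<subseteq> polys x n"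
  by (rule lift_Suc_mono_le[of "polys x"]) (rule polys_mono_Suc)

lemma polys_add: "f \<in> polys x n \<Longrightarrow> g \<in> polys x n \<Longrightarrow> f + g \<in> polys x n"
proof (induction n arbitrary: f g)
  case (Suc n)
  then obtain p q f' g' where "f = p + x * f'" "g = q + x * g'"
      "p \<in> P" "q \<in> P" "f' \<in> polys x n" "g' \<in> polys x n"
    by auto
  moreover from this have "f + g = (p + q) + x * (f' + g')"
    by (simp add: algebra_simps)
  ultimately show ?case
    using Suc.IH[of f' g'] add_P[of p q] unfolding polys.simps by blast
qed (simp add: add_P)

lemma polys_scale: "v \<in> V \<Longrightarrow> f \<in> polys x n \<Longrightarrow> v * f \<in> polys x n"
proof (induction n arbitrary: f)
  case (Suc n)
  then obtain p f' where "f = p + x * f'" "p \<in> P" "f' \<in> polys x n"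
    by auto
  moreover from this have "v * f = (v * p) + x * (v * f')"
    by (simp add: algebra_simps)
  ultimately show ?case
    using Suc.IH[of f'] Suc.prems(1) mult_P[of v p] unfolding polys.simps by blast
qed (simp add: mult_P)

lemma polys_shift: "f \<in> polys x n \<Longrightarrow> x * f \<in> polys x (Suc n)"
  using zero_P add_0[of "x * f"] unfolding polys.simps by (metis (mono_tags, lifting) mem_Collect_eq)

lemma polys_shift_power: "f \<in> polys x n \<Longrightarrow> x ^ k * f \<in> polys x (k + n)"
proof (induction k)
  case (Suc k)
  then show ?case
    using polys_shift[of "x ^ k * f" x "k + n"] by (simp add: mult.assoc)
qed simp

lemma polys_mult: "f \<in> polys x m \<Longrightarrow> g \<in> polys x n \<Longrightarrow> f * g \<in> polys x (m + n)"
proof (induction m arbitrary: f)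
  case 0
  then show ?case using P_subset_V polys_scale by auto
next
  case (Suc m)
  then obtain p f' where f: "f = p + x * f'" "p \<in> P" "f' \<in> polys x m"
    by auto
  have "p * g \<in> polys x (Suc m + n)"
    using polys_scale[of p g x n] P_subset_V f(2) Suc.prems(2) polys_mono[of n "Suc m + n" x] by auto
  moreover have "x * (f' * g) \<in> polys x (Suc m + n)"
    using polys_shift[OF Suc.IH[OF f(3) Suc.prems(2)]] by simp
  ultimately show ?case
    using polys_add f(1) by (simp only: distrib_right mult.assoc)
qed

lemma polys_top:
  "f \<in> polys x (Suc n) \<Longrightarrow> \<exists>g\<in>polys x n. \<exists>p\<in>P. f = g + p * x ^ Suc n"
proof (induction n arbitrary: f)
  case 0
  then show ?case by (auto simp: mult.commute)
next
  case (Suc n)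
  then obtain q f' where f: "f = q + x * f'" "q \<in> P" "f' \<in> polys x (Suc n)"
    by auto
  then obtain g p where g: "g \<in> polys x n" "p \<in> P" "f' = g + p * x ^ Suc n"
    using Suc.IH by blast
  then have "f = (q + x * g) + p * x ^ Suc (Suc n)"
    using f(1) by (simp add: algebra_simps)
  moreover have "q + x * g \<in> polys x (Suc n)"
    using f(2) g(1) by auto
  ultimately show ?case
    using g(2) by blast
qed

text \<open>
  A polynomial in \<open>y\<close> becomes one in \<open>x\<close> when multiplied by \<open>x\<^sup>n\<close>, because \<open>x y\<close> is a scalar from \<open>V\<close>.
\<close>

lemma polys_reverse:
  assumes "x * y \<in> V" and "f \<in> polys y n"
  shows "x ^ n * f \<in> polys x n"
  using assms(2)
proof (induction n arbitrary: f)
  case (Suc n)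
  then obtain p f' where f: "f = p + y * f'" "p \<in> P" "f' \<in> polys y n"
    by auto
  have 1: "x ^ Suc n * p \<in> polys x (Suc n)"
    using polys_shift_power[of p x 0 "Suc n"] f(2) by simp
  have "(x * y) * (x ^ n * f') \<in> polys x n"
    by (rule polys_scale[OF assms(1) Suc.IH[OF f(3)]])
  then have "(x * y) * (x ^ n * f') \<in> polys x (Suc n)"
    using polys_mono_Suc by blast
  moreover have "x ^ Suc n * f = x ^ Suc n * p + (x * y) * (x ^ n * f')"
    using f(1) by (simp add: algebra_simps)
  ultimately show ?case
    using polys_add[OF 1] by metis
qed simp

text \<open>
  The classical argument that the maximal ideal cannot generate the unit ideal both in \<open>V[x]\<close> and in
  \<open>V[1/x]\<close>. Dividing one relation by the other, as in the Euclidean algorithm, lowers the larger of the two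
  degrees. It suffices that \<open>x y\<close> lies in \<open>V\<close>: multiplying by \<open>1 - q\<close> with \<open>q \<in> P\<close> replaces the division by
  a unit, since \<open>1 - q\<close> is congruent to 1 modulo \<open>P\<close>.
\<close>

lemma not_both_one_in_polys:
  assumes "x * y \<in> V" "1 \<in> polys x n" "1 \<in> polys y m"
  shows False
proof -
  have reduce: "1 \<in> polys x (n - 1) \<and> n > 0"
    if xy: "x * y \<in> V" and 1: "1 \<in> polys x n" "1 \<in> polys y m" and "m \<le> n" for x y n m
  proof -
    have "m > 0"
      using 1(2) one_notin_P by (cases m) auto
    then obtain m' where m: "m = Suc m'"
      using gr0_implies_Suc by blast
    from \<open>m \<le> n\<close> obtain n' where n: "n = Suc n'"
      using m by (cases n) auto
    obtain q f where f: "1 = q + y * f" "q \<in> P" "f \<in> polys y m'"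
      using 1(2) m by auto
    have "(1 - q) * x ^ m = (x * y) * (x ^ m' * f)"
      using arg_cong[OF f(1), of "\<lambda>u. (u - q) * x ^ m"] by (simp add: m algebra_simps)
    \<comment> \<open>The relation for y rewrites x^m in lower degree, which removes the top term of the relation for x.\<close>
    then have low: "(1 - q) * x ^ m \<in> polys x m'"
      using polys_scale[OF xy polys_reverse[OF xy f(3)]] by simp
    obtain g p where g: "g \<in> polys x n'" "p \<in> P" "1 = g + p * x ^ n"
      using polys_top 1(1) n by blast
    have "x ^ (n - m) * ((1 - q) * x ^ m) \<in> polys x n'"
      using polys_shift_power[OF low, of "n - m"] \<open>m \<le> n\<close> n m by simp
    then have "p * (x ^ (n - m) * ((1 - q) * x ^ m)) \<in> polys x n'"
      using polys_scale g(2) P_subset_V by blast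
    moreover have "(1 - q) * g \<in> polys x n'"
      using polys_scale[OF one_minus_V[OF f(2)] g(1)] .
    moreover have "x ^ n = x ^ (n - m) * x ^ m"
      using \<open>m \<le> n\<close> by (simp flip: power_add)
    then have "1 - q = (1 - q) * g + p * (x ^ (n - m) * ((1 - q) * x ^ m))"
      using arg_cong[OF g(3), of "\<lambda>u. (1 - q) * u"] by (simp add: algebra_simps)
    ultimately have "1 - q \<in> polys x n'"
      using polys_add by metis
    then have "(1 - q) + q \<in> polys x n'"
      using polys_add f(2) P_subset_polys by blast
    then show ?thesis
      using n by simp
  qed
  show ?thesis
    using assms
  proof (induction "n + m" arbitrary: n m rule: less_induct)
    case less
    show ?case
    proof (cases "m \<le> n")
      case True
      from reduce[OF less.prems True] less.hyps[of "n - 1" m] less.prems show ?thesis by simp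
    next
      case False
      have "1 \<in> polys y (m - 1) \<and> m > 0"
        using reduce[of y x m n] less.prems False by (simp add: mult.commute)
      with less.hyps[of n "m - 1"] less.prems show ?thesis by simp
    qed
  qed
qed

end

text \<open>
  A Manis valuation pair: the substitute for a valuation ring with its maximal ideal when the ambient ring is
  not a field. Functions on a set of points with values in a field form such a ring, and their inverses are
  only defined away from their zeros.
\<close>

locale manis_pair = ring_with_ideal +
  assumes prime: "x \<in> V \<Longrightarrow> y \<in> V \<Longrightarrow> x * y \<in> P \<Longrightarrow> x \<in> P \<or> y \<in> P"
    and manis: "x \<notin> V \<Longrightarrow> \<exists>p\<in>P. x * p \<in> V - P"

text \<open>
  Chevalley's extension theorem in Manis' form. Zorn's lemma is applied to the ideals alone: the subring is
  recovered from \<open>P\<close> as the set of all \<open>v\<close> with \<open>v P \<subseteq> P\<close>. If \<open>x\<close> lies outside that ring, then the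
  polynomials in \<open>x\<close> with coefficients in \<open>P\<close> form a larger candidate, so they contain 1; splitting off the
  constant term gives \<open>1 = p + x y\<close>, and this \<open>y\<close> is the required element of \<open>P\<close>.
\<close>

theorem ex_manis_pair:
  assumes "ring_with_ideal A M"
  shows "\<exists>V P. manis_pair V P \<and> A \<subseteq> V \<and> M \<subseteq> P"
proof -
  interpret A: ring_with_ideal A M by fact
  define good where "good P \<longleftrightarrow> M \<subseteq> P \<and> 1 \<notin> P \<and> (\<forall>x\<in>P. \<forall>y\<in>P. x + y \<in> P \<and> x * y \<in> P) \<and>
    (\<forall>x\<in>A. \<forall>y\<in>P. x * y \<in> P)" for P
  have "\<exists>P\<in>Collect good. \<forall>Q\<in>Collect good. P \<subseteq> Q \<longrightarrow> Q = P"
  proof (rule subset_Zorn_nonempty)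
    have "good M"
      unfolding good_def
      using A.one_notin_P A.add_P A.mult_P A.P_subset_V by blast
    then show "Collect good \<noteq> {}" by blast
  next
    fix C assume C: "C \<noteq> {}" "subset.chain (Collect good) C"
    have good: "good P" if "P \<in> C" for P
      using C(2) that by (auto simp: subset_chain_def)
    have both: "\<exists>P\<in>C. x \<in> P \<and> y \<in> P" if "x \<in> \<Union>C" "y \<in> \<Union>C" for x y
      using that C(2) unfolding subset_chain_def by blast
    have "good (\<Union>C)"
      unfolding good_def
    proof (intro conjI ballI)
      show "M \<subseteq> \<Union>C"
        using C(1) good unfolding good_def by blast
      show "1 \<notin> \<Union>C"
        using good unfolding good_def by blast
      show "x + y \<in> \<Union>C" "x * y \<in> \<Union>C" if "x \<in> \<Union>C" "y \<in> \<Union>C" for x y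
        using both[OF that] good unfolding good_def by blast+
      show "x * y \<in> \<Union>C" if "x \<in> A" "y \<in> \<Union>C" for x y
        using that good unfolding good_def by blast
    qed
    then show "\<Union>C \<in> Collect good" by simp
  qed
  then obtain P where P: "good P" and max: "\<And>Q. good Q \<Longrightarrow> P \<subseteq> Q \<Longrightarrow> Q = P"
    by blast
  \<comment> \<open>The idealizer: the largest ring in which the maximal P is an ideal.\<close>
  define V where "V = {v. \<forall>p\<in>P. v * p \<in> P}"
  have AV: "A \<subseteq> V"
    using P unfolding good_def V_def by blast
  interpret ring_with_ideal V P
  proof
    show "1 \<in> V" by (simp add: V_def)
    show "x + y \<in> V" if "x \<in> V" "y \<in> V" for x y
      using that P by (auto simp: V_def good_def distrib_right)
    show "x * y \<in> V" if "x \<in> V" "y \<in> V" for x y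
      using that by (auto simp: V_def mult.assoc)
    have "- 1 \<in> A"
      using A.uminus_V A.one_V by blast
    then have "- p \<in> P" if "p \<in> P" for p
      using that P unfolding good_def by (metis mult_minus1)
    then show "- x \<in> V" if "x \<in> V" for x
      using that by (auto simp: V_def)
    show "P \<subseteq> V"
      using P by (auto simp: V_def good_def)
    show "0 \<in> P"
      using A.zero_P P by (auto simp: good_def)
    show "x + y \<in> P" if "x \<in> P" "y \<in> P" for x y
      using that P by (simp add: good_def)
    show "x * y \<in> P" if "x \<in> V" "y \<in> P" for x y
      using that by (simp add: V_def)
    show "1 \<notin> P"
      using P by (simp add: good_def)
  qed
  have one_poly: "\<exists>n. 1 \<in> polys x n" if x: "x \<notin> V" for x
  proof (rule ccontr)
    assume no: "\<not> ?thesis"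
    let ?Q = "\<Union>n. polys x n"
    have both: "\<exists>n. f \<in> polys x n \<and> g \<in> polys x n" if "f \<in> ?Q" "g \<in> ?Q" for f g
    proof -
      from that obtain m n where "f \<in> polys x m" "g \<in> polys x n" by blast
      then have "f \<in> polys x (max m n)" "g \<in> polys x (max m n)"
        using polys_mono[of m "max m n" x] polys_mono[of n "max m n" x] by auto
      then show ?thesis by blast
    qed
    have PQ: "P \<subseteq> ?Q"
      using P_subset_polys by blast
    have "good ?Q"
      unfolding good_def
    proof (intro conjI ballI)
      show "M \<subseteq> ?Q"
        using PQ P by (auto simp: good_def)
      show "1 \<notin> ?Q"
        using no by blast
      show "f + g \<in> ?Q" if "f \<in> ?Q" "g \<in> ?Q" for f g
        using both[OF that] polys_add by blast
      show "f * g \<in> ?Q" if "f \<in> ?Q" "g \<in> ?Q" for f g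
        using that polys_mult by blast
      show "v * f \<in> ?Q" if "v \<in> A" "f \<in> ?Q" for v f
        using that polys_scale AV by blast
    qed
    then have "?Q = P"
      using max PQ by blast
    moreover have "x * p \<in> ?Q" if "p \<in> P" for p
      using polys_shift[of p x 0] that by (metis UN_iff UNIV_I polys.simps(1))
    ultimately have "x \<in> V"
      by (simp add: V_def)
    with x show False ..
  qed
  have prime: "x \<in> P \<or> y \<in> P" if x: "x \<in> V" and y: "y \<in> V" and xy: "x * y \<in> P" for x y
  proof (rule disjCI)
    assume "y \<notin> P"
    let ?Q = "{p + y * v | p v. p \<in> P \<and> v \<in> V}"
    have V0: "0 \<in> V"
      using zero_P P_subset_V by blast
    have PQ: "P \<subseteq> ?Q"
    proof
      fix p assume "p \<in> P"
      moreover have "p = p + y * 0" by simp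
      ultimately show "p \<in> ?Q"
        using V0 by blast
    qed
    have yQ: "y \<in> ?Q"
    proof -
      have "y = 0 + y * 1" by simp
      then show ?thesis
        using zero_P one_V by blast
    qed
    have QV: "?Q \<subseteq> V"
      using P_subset_V add_V mult_V y by blast
    have add: "f + g \<in> ?Q" if "f \<in> ?Q" "g \<in> ?Q" for f g
    proof -
      from that obtain p v q w where *: "f = p + y * v" "g = q + y * w" "p \<in> P" "q \<in> P" "v \<in> V" "w \<in> V"
        by blast
      then have "f + g = (p + q) + y * (v + w)"
        by (simp add: algebra_simps)
      then show ?thesis
        using * add_P add_V by blast
    qed
    have mult: "u * f \<in> ?Q" if "u \<in> V" "f \<in> ?Q" for u f
    proof -
      from that obtain p v where *: "f = p + y * v" "p \<in> P" "v \<in> V"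
        by blast
      then have "u * f = u * p + y * (u * v)"
        by (simp add: algebra_simps)
      then show ?thesis
        using * mult_P mult_V that(1) by blast
    qed
    have "\<not> good ?Q"
      using max[OF _ PQ] yQ \<open>y \<notin> P\<close> by blast
    moreover have "M \<subseteq> ?Q"
      using PQ P by (auto simp: good_def)
    moreover have "\<forall>f\<in>?Q. \<forall>g\<in>?Q. f + g \<in> ?Q \<and> f * g \<in> ?Q"
      using add mult QV by blast
    moreover have "\<forall>u\<in>A. \<forall>f\<in>?Q. u * f \<in> ?Q"
      using mult AV by blast
    ultimately have "1 \<in> ?Q"
      unfolding good_def by blast
    then obtain p v where pv: "1 = p + y * v" "p \<in> P" "v \<in> V"
      by blast
    have "x = x * p + v * (x * y)"
      using arg_cong[OF pv(1), of "\<lambda>u. x * u"] by (simp add: algebra_simps)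
    then show "x \<in> P"
      using add_P mult_P pv x xy by metis
  qed
  have "manis_pair V P"
  proof (unfold_locales)
    show "x \<in> P \<or> y \<in> P" if "x \<in> V" "y \<in> V" "x * y \<in> P" for x y
      using prime that .
    show "\<exists>p\<in>P. x * p \<in> V - P" if x: "x \<notin> V" for x
    proof -
      obtain n where n: "1 \<in> polys x n"
        using one_poly[OF x] by blast
      then obtain k where k: "n = Suc k"
        using one_notin_P by (cases n) auto
      then obtain p y where y: "1 = p + x * y" "p \<in> P" "y \<in> polys x k"
        using n by auto
      have xy: "x * y = 1 - p"
        using y(1) by (simp add: algebra_simps)
      have xyV: "x * y \<in> V" and xyP: "x * y \<notin> P"
        using xy one_minus_V[OF y(2)] one_minus_notin_P[OF y(2)] by simp_all
      have yV: "y \<in> V"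
        using one_poly[of y] not_both_one_in_polys[OF xyV n] by blast
      \<comment> \<open>Multiplying the expression of y as a polynomial in x by y^k shows that y^(k+1) is the value at y of a
        polynomial with coefficients in P, hence lies in P.\<close>
      have "y \<in> P"
      proof (rule ccontr)
        assume "y \<notin> P"
        then have pow: "y ^ j \<notin> P \<and> y ^ j \<in> V" for j
        proof (induction j)
          case 0
          show ?case using one_notin_P one_V by simp
        next
          case (Suc j)
          then show ?case
            using prime[OF yV, of "y ^ j"] mult_V[OF yV, of "y ^ j"] \<open>y \<notin> P\<close> by auto
        qed
        have "y * x \<in> V" using xyV by (simp add: mult.commute)
        from polys_reverse[OF this y(3)] have "y ^ k * y \<in> polys y k" .
        then have "y ^ Suc k \<in> polys y k" by (simp add: mult.commute)
        moreover have "polys y j \<subseteq> P" for j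
        proof (induction j)
          case (Suc j)
          then show ?case
            using add_P mult_P[OF yV] unfolding polys.simps by blast
        qed simp
        ultimately show False
          using pow by blast
      qed
      then show ?thesis
        using xyV xyP by blast
    qed
  qed
  moreover have "M \<subseteq> P"
    using P by (simp add: good_def)
  ultimately show ?thesis
    using AV by blast
qed

section \<open>Spaces of polynomials and their top monomials\<close>

text \<open>
  More unknowns than equations: Gaussian elimination of one equation and one unknown at a time.
\<close>

lemma homogeneous_system_nontrivial:
  fixes a :: "'j \<Rightarrow> 'r \<Rightarrow> 'k::field"
  assumes "finite R" "finite J" "card R < card J"
  shows "\<exists>c. (\<exists>j\<in>J. c j \<noteq> 0) \<and> (\<forall>r\<in>R. (\<Sum>j\<in>J. c j * a j r) = 0)"
  using assms
proof (induction R arbitrary: J a rule: finite_induct)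
  case empty
  then have "J \<noteq> {}" by auto
  then show ?case by (auto intro!: exI[of _ "\<lambda>_. 1"])
next
  case (insert r R)
  show ?case
  proof (cases "\<forall>j\<in>J. a j r = 0")
    case True
    from insert.IH[of J a] insert.prems insert.hyps obtain c
      where "\<exists>j\<in>J. c j \<noteq> 0" "\<forall>r\<in>R. (\<Sum>j\<in>J. c j * a j r) = 0"
      by auto
    with True show ?thesis by auto
  next
    case False
    then obtain i where i: "i \<in> J" "a i r \<noteq> 0" by blast
    let ?a = "\<lambda>j s. a j s - a j r / a i r * a i s"
    have "card R < card (J - {i})"
      using insert.prems insert.hyps i by simp
    from insert.IH[OF _ this, of ?a] insert.prems obtain c
      where c: "\<exists>j\<in>J-{i}. c j \<noteq> 0" "\<And>s. s \<in> R \<Longrightarrow> (\<Sum>j\<in>J-{i}. c j * ?a j s) = 0"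
      by auto
    define d where "d = - (\<Sum>j\<in>J-{i}. c j * a j r) / a i r"
    let ?c = "c(i := d)"
    have split: "(\<Sum>j\<in>J. ?c j * a j s) = d * a i s + (\<Sum>j\<in>J-{i}. c j * a j s)" for s
      using i(1) insert.prems(1) by (simp add: sum.remove)
    have "(\<Sum>j\<in>J. ?c j * a j s) = 0" if "s \<in> insert r R" for s
    proof (cases "s = r")
      case True
      then show ?thesis
        unfolding split using i(2) by (simp add: d_def)
    next
      case False
      have "(\<Sum>j\<in>J-{i}. c j * ?a j s) =
          (\<Sum>j\<in>J-{i}. c j * a j s) - (\<Sum>j\<in>J-{i}. c j * a j r) / a i r * a i s"
        by (simp add: right_diff_distrib sum_subtractf sum_distrib_right sum_divide_distrib mult.assoc)
      then have "(\<Sum>j\<in>J-{i}. c j * a j s) - (\<Sum>j\<in>J-{i}. c j * a j r) / a i r * a i s = 0"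
        using c(2)[of s] that False by simp
      then show ?thesis
        unfolding split by (simp add: d_def algebra_simps)
    qed
    moreover have "\<exists>j\<in>J. ?c j \<noteq> 0"
      using c(1) by auto
    ultimately show ?thesis by blast
  qed
qed

lemma lookup_scale [simp]: "Poly_Mapping.lookup (scale c f) m = c * Poly_Mapping.lookup f m"
proof -
  have "scale c f = Poly_Mapping.map ((*) c) f"
    by (simp add: scale_def mult_map_scale_conv_mult)
  then show ?thesis
    by (simp add: Poly_Mapping.map.rep_eq when_def)
qed

lemma lookup_mon_mult: "Poly_Mapping.lookup (mon m * f) (m + q) = Poly_Mapping.lookup (f :: 'k::field bipoly) q"
proof -
  have "Poly_Mapping.lookup (mon m * f) (m + q) =
      (\<Sum>l. Poly_Mapping.lookup (mon m :: 'k bipoly) l * (\<Sum>q'. Poly_Mapping.lookup f q' when m + q = l + q'))"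
    by (simp add: lookup_mult)
  also have "\<dots> = (\<Sum>l. (\<Sum>q'. Poly_Mapping.lookup f q' when m + q = l + q') when m = l)"
    by (intro Sum_any.cong) (auto simp: lookup_single when_def)
  also have "\<dots> = Poly_Mapping.lookup f q"
    by simp
  finally show ?thesis .
qed

lemma keys_mon_mult: "Poly_Mapping.keys (mon m * f :: 'k::field bipoly) = (+) m ` Poly_Mapping.keys f"
proof
  show "Poly_Mapping.keys (mon m * f) \<subseteq> (+) m ` Poly_Mapping.keys f"
  proof
    fix k assume "k \<in> Poly_Mapping.keys (mon m * f)"
    then obtain l q where "k = l + q" "l \<in> Poly_Mapping.keys (mon m :: 'k bipoly)"
        "q \<in> Poly_Mapping.keys f"
      using keys_mult[of "mon m" f] by blast
    then show "k \<in> (+) m ` Poly_Mapping.keys f"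
      by simp
  qed
  show "(+) m ` Poly_Mapping.keys f \<subseteq> Poly_Mapping.keys (mon m * f)"
    by (auto simp: in_keys_iff lookup_mon_mult)
qed

lemma sum_fun_apply: "sum f A x = (\<Sum>a\<in>A. f a x)"
  by (induction A rule: infinite_finite_induct) auto

text \<open>
  Meant for polynomials all of whose monomials have the same weight: there the second exponent orders the
  monomials linearly, and the top is the leading monomial.
\<close>

definition is_top :: "'k::field bipoly \<Rightarrow> monomial \<Rightarrow> bool"
  where "is_top f t \<longleftrightarrow> t \<in> Poly_Mapping.keys f \<and> (\<forall>m\<in>Poly_Mapping.keys f. snd m \<le> snd t)"

text \<open>
  For a space of homogeneous polynomials \<open>T\<close> is then determined by \<open>W\<close> and has as many elements as the
  dimension of \<open>W\<close>, so that the two lemmas on existence of nonzero solutions below can be stated without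
  mentioning dimensions.
\<close>

definition has_tops :: "'k::field bipoly set \<Rightarrow> monomial set \<Rightarrow> bool"
  where "has_tops W T \<longleftrightarrow>
    (\<forall>t\<in>T. \<exists>f\<in>W. is_top f t) \<and> (\<forall>f\<in>W. f \<noteq> 0 \<longrightarrow> (\<exists>t\<in>T. is_top f t))"

lemma ex_key: "f \<noteq> 0 \<Longrightarrow> \<exists>m. m \<in> Poly_Mapping.keys f"
  by (metis in_keys_iff lookup_zero poly_mapping_eqI)

lemma ex_top:
  assumes "f \<noteq> (0 :: 'k::field bipoly)"
  shows "\<exists>t. is_top f t"
proof -
  have "finite (Poly_Mapping.keys f)" "Poly_Mapping.keys f \<noteq> {}"
    using ex_key[OF assms] by auto
  then obtain t where "t \<in> Poly_Mapping.keys f" "Max (snd ` Poly_Mapping.keys f) = snd t"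
    by (rule obtains_MAX)
  then have "is_top f t"
    unfolding is_top_def by (metis Max_ge finite_imageI finite_keys imageI)
  then show ?thesis ..
qed

lemma bipoly_sum_mon: "(\<Sum>m\<in>Poly_Mapping.keys f. scale (Poly_Mapping.lookup f m) (mon m)) = f"
proof (rule poly_mapping_eqI)
  fix k
  have "(\<Sum>m\<in>Poly_Mapping.keys f. Poly_Mapping.lookup f m * (if m = k then 1 else 0)) =
      (\<Sum>m\<in>Poly_Mapping.keys f. if m = k then Poly_Mapping.lookup f m else 0)"
    by (intro sum.cong) auto
  also have "\<dots> = Poly_Mapping.lookup f k"
    by (simp add: in_keys_iff)
  finally show "Poly_Mapping.lookup
      (\<Sum>m\<in>Poly_Mapping.keys f. scale (Poly_Mapping.lookup f m) (mon m)) k = Poly_Mapping.lookup f k"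
    by (simp add: lookup_sum lookup_single when_def)
qed

lemma kvec_span_mon: "kvec.span (mon ` B) = {f :: 'k::field bipoly. Poly_Mapping.keys f \<subseteq> B}"
proof
  have "kvec.subspace {f :: 'k bipoly. Poly_Mapping.keys f \<subseteq> B}"
  proof (rule kvec.subspaceI)
    show "f + g \<in> {f. Poly_Mapping.keys f \<subseteq> B}"
      if "f \<in> {f. Poly_Mapping.keys f \<subseteq> B}" "g \<in> {f. Poly_Mapping.keys f \<subseteq> B}" for f g :: "'k bipoly"
      using that Poly_Mapping.keys_add[of f g] by blast
  qed (auto simp: in_keys_iff subset_iff)
  then show "kvec.span (mon ` B) \<subseteq> {f :: 'k bipoly. Poly_Mapping.keys f \<subseteq> B}"
    by (rule kvec.span_minimal[rotated]) auto
  show "{f :: 'k bipoly. Poly_Mapping.keys f \<subseteq> B} \<subseteq> kvec.span (mon ` B)"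
  proof
    fix f :: "'k bipoly" assume "f \<in> {f. Poly_Mapping.keys f \<subseteq> B}"
    then have "(\<Sum>m\<in>Poly_Mapping.keys f. scale (Poly_Mapping.lookup f m) (mon m)) \<in> kvec.span (mon ` B)"
      by (intro kvec.span_sum kvec.span_scale kvec.span_base) auto
    then show "f \<in> kvec.span (mon ` B)"
      by (simp add: bipoly_sum_mon)
  qed
qed

lemma independent_mon: "kvec.independent (mon ` B :: 'k::field bipoly set)"
  unfolding kvec.dependent_def
proof
  assume "\<exists>f\<in>mon ` B. (f :: 'k bipoly) \<in> kvec.span (mon ` B - {f})"
  then obtain m where m: "m \<in> B" "(mon m :: 'k bipoly) \<in> kvec.span (mon ` B - {mon m})"
    by blast
  have "mon ` B - {mon m :: 'k bipoly} \<subseteq> mon ` (B - {m})"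
    by auto
  then have "(mon m :: 'k bipoly) \<in> kvec.span (mon ` (B - {m}))"
    using m(2) kvec.span_mono by blast
  then show False
    by (simp add: kvec_span_mon)
qed

lemma keys_scale_mon: "c \<noteq> 0 \<Longrightarrow> Poly_Mapping.keys (scale c (mon q)) = {q}"
  by (intro set_eqI) (simp add: in_keys_iff lookup_single when_def)

lemma scale_mon_mem:
  assumes "kvec.subspace I" "Poly_Mapping.keys f = {m}" "f \<in> I"
  shows "mon m \<in> I"
proof -
  have "f = scale (Poly_Mapping.lookup f m) (mon m)"
    using bipoly_sum_mon[of f] assms(2) by simp
  moreover have "Poly_Mapping.lookup f m \<noteq> 0"
    using assms(2) by (metis in_keys_iff singletonI)
  ultimately have "mon m = scale (inverse (Poly_Mapping.lookup f m)) f"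
    by (metis kvec.scale_left_imp_eq kvec.scale_one kvec.scale_scale left_inverse)
  then show ?thesis
    using kvec.subspace_scale[OF assms(1,3)] by metis
qed

lemma subspace_keys: "kvec.subspace {f :: 'k::field bipoly. Poly_Mapping.keys f \<subseteq> B}"
  using kvec.subspace_span[of "mon ` B"] by (simp add: kvec_span_mon)

text \<open>
  One polynomial of \<open>W\<close> for each element of \<open>T\<close>, combined so as to vanish at fewer than \<open>card T\<close> monomials;
  the combination is not 0 because the largest top that occurs in it cannot cancel.
\<close>

lemma ex_nonzero_vanishing:
  assumes W: "kvec.subspace W" and tops: "has_tops W T"
    and inj: "inj_on snd T" and fin: "finite T" "finite L" and less: "card L < card T"
  shows "\<exists>w\<in>W. w \<noteq> 0 \<and> (\<forall>m\<in>L. Poly_Mapping.lookup w m = 0)"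
proof -
  from tops obtain f where f: "\<And>t. t \<in> T \<Longrightarrow> f t \<in> W \<and> is_top (f t) t"
    unfolding has_tops_def by metis
  obtain c where c: "\<exists>t\<in>T. c t \<noteq> 0"
      "\<And>m. m \<in> L \<Longrightarrow> (\<Sum>t\<in>T. c t * Poly_Mapping.lookup (f t) m) = 0"
    using homogeneous_system_nontrivial[OF fin(2,1) less, of "\<lambda>t. Poly_Mapping.lookup (f t)"] by blast
  define w where "w = (\<Sum>t\<in>T. scale (c t) (f t))"
  have lookup_w: "Poly_Mapping.lookup w m = (\<Sum>t\<in>T. c t * Poly_Mapping.lookup (f t) m)" for m
    by (simp add: w_def lookup_sum)
  have "w \<in> W"
    unfolding w_def using f kvec.subspace_scale[OF W] by (intro kvec.subspace_sum[OF W]) blast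
  let ?S = "{t \<in> T. c t \<noteq> 0}"
  have "finite ?S" "?S \<noteq> {}"
    using fin c(1) by auto
  then obtain t0 where t0: "t0 \<in> ?S" "\<And>t. t \<in> ?S \<Longrightarrow> snd t \<le> snd t0"
    using obtains_MAX[of ?S snd] by (metis (no_types, lifting) Max_ge finite_imageI imageI)
  have "c t * Poly_Mapping.lookup (f t) t0 = 0" if t: "t \<in> T - {t0}" for t
  proof (cases "c t = 0")
    case False
    then have "snd t \<noteq> snd t0" "snd t \<le> snd t0"
      using inj_onD[OF inj, of t t0] t t0 by auto
    then have "t0 \<notin> Poly_Mapping.keys (f t)"
      using f[of t] t unfolding is_top_def by fastforce
    then show ?thesis by (simp add: in_keys_iff)
  qed simp
  then have "(\<Sum>t\<in>T-{t0}. c t * Poly_Mapping.lookup (f t) t0) = 0"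
    by (intro sum.neutral) blast
  then have "Poly_Mapping.lookup w t0 = c t0 * Poly_Mapping.lookup (f t0) t0"
    using fin t0(1) by (simp add: lookup_w sum.remove[of T t0])
  moreover have "Poly_Mapping.lookup (f t0) t0 \<noteq> 0"
    using f[of t0] t0(1) by (simp add: is_top_def in_keys_iff)
  ultimately have "w \<noteq> 0"
    using t0(1) by auto
  with \<open>w \<in> W\<close> show ?thesis
    using c(2) lookup_w by auto
qed

text \<open>
  An element of \<open>W\<close> without monomials in \<open>T\<close> is 0, so membership in \<open>W\<close> turns a linear relation between the
  coefficients at \<open>T\<close> into a relation between polynomials.
\<close>

lemma ex_nontrivial_relation:
  assumes W: "kvec.subspace W" and tops: "has_tops W T"
    and fin: "finite T" "finite L" and less: "card T < card L"
    and s: "\<And>m. m \<in> L \<Longrightarrow> s m \<in> W"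
  shows "\<exists>c. (\<exists>m\<in>L. c m \<noteq> 0) \<and> (\<Sum>m\<in>L. scale (c m) (s m)) = 0"
proof -
  obtain c where c: "\<exists>m\<in>L. c m \<noteq> 0"
      "\<And>t. t \<in> T \<Longrightarrow> (\<Sum>m\<in>L. c m * Poly_Mapping.lookup (s m) t) = 0"
    using homogeneous_system_nontrivial[OF fin less, of "\<lambda>m. Poly_Mapping.lookup (s m)"] by blast
  let ?w = "\<Sum>m\<in>L. scale (c m) (s m)"
  have "?w \<in> W"
    using s kvec.subspace_scale[OF W] by (intro kvec.subspace_sum[OF W]) blast
  moreover have "t \<notin> Poly_Mapping.keys ?w" if "t \<in> T" for t
    using c(2)[OF that] by (simp add: in_keys_iff lookup_sum)
  ultimately have "?w = 0"
    using tops unfolding has_tops_def is_top_def by blast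
  with c(1) show ?thesis by blast
qed

section \<open>Limits of families of spaces of polynomials\<close>

text \<open>
  The elements of \<open>V\<close> are the functions on \<open>X\<close> that stay finite along the limit, those of \<open>P\<close> the ones that tend
  to 0. The last assumption makes all notions depend only on the values on \<open>X\<close>.
\<close>

locale limit_place = manis_pair V P
  for V P :: "('i \<Rightarrow> 'k::field) set" +
  fixes X :: "'i set"
  assumes vanishing: "(\<And>x. x \<in> X \<Longrightarrow> f x = 0) \<Longrightarrow> f \<in> P"
begin

text \<open>
  This is what properness of projective space provides: a point with homogeneous coordinates \<open>g j\<close> has a
  limit, because after rescaling the coordinates stay finite and do not all tend to 0. Starting from a
  coordinate that can be normalised, each further one that fails to be finite after scaling takes over, and then
  all earlier ones tend to 0.
\<close>

lemma ex_normalising_factor: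
  assumes "finite J" and nonzero: "\<And>x. x \<in> X \<Longrightarrow> \<exists>j\<in>J. g j x \<noteq> 0"
  shows "\<exists>h. (\<forall>j\<in>J. h * g j \<in> V) \<and> (\<exists>j\<in>J. h * g j \<notin> P)"
proof -
  have "\<exists>j\<in>J. \<exists>h. h * g j \<in> V - P"
  proof (rule ccontr)
    assume no: "\<not> ?thesis"
    have inP: "h * g j \<in> P" if "j \<in> J" for h j
    proof (rule ccontr)
      assume "h * g j \<notin> P"
      then have "h * g j \<notin> V"
        using no that by blast
      then obtain p where "h * g j * p \<in> V - P"
        using manis by blast
      then have "(h * p) * g j \<in> V - P"
        by (simp add: ac_simps)
      with no that show False by blast
    qed
    \<comment> \<open>Otherwise every multiple of every coordinate tends to 0, hence so does the function 1, which is a combination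
      of the coordinates.\<close>
    obtain i where i: "\<And>x. x \<in> X \<Longrightarrow> i x \<in> J \<and> g (i x) x \<noteq> 0"
      using nonzero by metis
    define u where "u j x = (if i x = j then inverse (g j x) else 0)" for j x
    have "(\<Sum>j\<in>J. u j x * g j x) = 1" if "x \<in> X" for x
    proof -
      have "(\<Sum>j\<in>J. u j x * g j x) = (\<Sum>j\<in>{i x}. u j x * g j x)"
        using i[OF that] by (intro sum.mono_neutral_right assms(1)) (auto simp: u_def)
      then show ?thesis
        using i[OF that] by (simp add: u_def)
    qed
    then have "(\<Sum>j\<in>J. u j * g j) - 1 \<in> P"
      by (intro vanishing) (simp add: sum_fun_apply)
    moreover have "(\<Sum>j\<in>J. u j * g j) \<in> P"
      using inP by (rule sum_P)
    ultimately have "(\<Sum>j\<in>J. u j * g j) - ((\<Sum>j\<in>J. u j * g j) - 1) \<in> P"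
      using diff_P by blast
    then show False
      using one_notin_P by simp
  qed
  then obtain i h0 where i: "i \<in> J" "h0 * g i \<in> V - P" by blast
  have "\<exists>h. (\<forall>j\<in>insert i K. h * g j \<in> V) \<and> (\<exists>j\<in>insert i K. h * g j \<notin> P)" if "finite K" for K
    using that
  proof (induction K rule: finite_induct)
    case empty
    then show ?case using i by blast
  next
    case (insert l K)
    then obtain h where h: "\<And>j. j \<in> insert i K \<Longrightarrow> h * g j \<in> V" "\<exists>j\<in>insert i K. h * g j \<notin> P"
      by blast
    show ?case
    proof (cases "h * g l \<in> V")
      case True
      then show ?thesis
        using h by blast
    next
      case False
      then obtain p where p: "p \<in> P" "h * g l * p \<in> V - P"
        using manis by blast
      have "h * p * g j \<in> V" if "j \<in> insert i K" for j
        using mult_P[OF h(1)[OF that] p(1)] P_subset_V by (simp add: ac_simps subset_iff)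
      moreover have "h * p * g l \<in> V - P"
        using p(2) by (simp add: ac_simps)
      ultimately show ?thesis
        by blast
    qed
  qed
  from this[OF assms(1)] show ?thesis
    using i(1) by (simp add: insert_absorb)
qed

abbreviation coeff_fun :: "('i \<Rightarrow> 'k bipoly) \<Rightarrow> monomial \<Rightarrow> 'i \<Rightarrow> 'k"
  where "coeff_fun s m \<equiv> \<lambda>x. Poly_Mapping.lookup (s x) m"

text \<open>
  The limit of \<open>s\<close> exists and is nonzero, and \<open>Q\<close> is the top monomial of the limit.
\<close>

definition leads :: "('i \<Rightarrow> 'k bipoly) \<Rightarrow> monomial \<Rightarrow> bool"
  where "leads s Q \<longleftrightarrow> (\<forall>m. coeff_fun s m \<in> V) \<and> coeff_fun s Q \<notin> P \<and>
    (\<forall>m. snd Q < snd m \<longrightarrow> coeff_fun s m \<in> P)"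

text \<open>
  The top monomials of the limit of the spaces \<open>Y x\<close>. Speaking of sections whose limit has a given top
  avoids constructing the limit space, which would live over the residue field of \<open>V\<close>.
\<close>

definition limit_monomials :: "('i \<Rightarrow> 'k bipoly set) \<Rightarrow> monomial set"
  where "limit_monomials Y = {Q. \<exists>s. (\<forall>x\<in>X. s x \<in> Y x) \<and> leads s Q}"

lemma limit_monomialsI:
  "(\<And>x. x \<in> X \<Longrightarrow> s x \<in> Y x) \<Longrightarrow> leads s Q \<Longrightarrow> Q \<in> limit_monomials Y"
  unfolding limit_monomials_def by blast

lemma limit_monomialsE:
  assumes "Q \<in> limit_monomials Y"
  obtains s where "\<forall>x\<in>X. s x \<in> Y x" and "leads s Q"
  using assms unfolding limit_monomials_def by blast

lemma limit_monomials_mono: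
  "(\<And>x. x \<in> X \<Longrightarrow> Y x \<subseteq> Y' x) \<Longrightarrow> limit_monomials Y \<subseteq> limit_monomials Y'"
  unfolding limit_monomials_def by blast

text \<open>
  Limits respect multiplication by a monomial; this is the source of the compatibility of arrows with
  division.
\<close>

lemma limit_monomials_mult:
  assumes Q: "Q \<in> limit_monomials Y"
    and mult: "\<And>x f. x \<in> X \<Longrightarrow> f \<in> Y x \<Longrightarrow> mon m * f \<in> Y' x"
  shows "m + Q \<in> limit_monomials Y'"
proof -
  from Q obtain s where s: "\<forall>x\<in>X. s x \<in> Y x" "leads s Q"
    by (rule limit_monomialsE)
  let ?s = "\<lambda>x. mon m * s x"
  have shift: "coeff_fun ?s (m + q) = coeff_fun s q" for q
    by (simp add: lookup_mon_mult)
  have other: "coeff_fun ?s k = 0" if "\<nexists>q. k = m + q" for k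
  proof
    fix x
    have "k \<notin> Poly_Mapping.keys (?s x)"
      using that by (auto simp: keys_mon_mult)
    then show "coeff_fun ?s k x = 0 x" by (simp add: in_keys_iff)
  qed
  have "leads ?s (m + Q)"
    unfolding leads_def
  proof (intro conjI allI impI)
    show "coeff_fun ?s k \<in> V" for k
    proof (cases "\<exists>q. k = m + q")
      case True
      then obtain q where q: "k = m + q" ..
      show ?thesis
        unfolding q shift using s(2) unfolding leads_def by blast
    next
      case False
      then have "coeff_fun ?s k = 0" by (rule other)
      then show ?thesis
        using zero_P P_subset_V by (simp add: subset_iff)
    qed
    show "coeff_fun ?s (m + Q) \<notin> P"
      unfolding shift using s(2) unfolding leads_def by blast
    show "coeff_fun ?s k \<in> P" if "snd (m + Q) < snd k" for k
    proof (cases "\<exists>q. k = m + q")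
      case True
      then obtain q where q: "k = m + q" ..
      with that have "snd Q < snd q" by simp
      then show ?thesis
        unfolding q shift using s(2) unfolding leads_def by blast
    next
      case False
      then have "coeff_fun ?s k = 0" by (rule other)
      then show ?thesis
        using zero_P by simp
    qed
  qed
  then show ?thesis
    by (rule limit_monomialsI[rotated]) (use mult s(1) in blast)
qed

lemma mon_in_limit_monomials:
  assumes "\<And>x. x \<in> X \<Longrightarrow> mon Q \<in> Y x"
  shows "Q \<in> limit_monomials Y"
proof -
  have 1: "coeff_fun (\<lambda>_. mon Q) m = (if m = Q then 1 else 0)" for m
    by (auto simp: lookup_single when_def)
  have "leads (\<lambda>_. mon Q) Q"
    unfolding leads_def 1 using one_V one_notin_P zero_P P_subset_V
    by (metis less_irrefl subsetD)
  with assms show ?thesis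
    by (rule limit_monomialsI)
qed

text \<open>
  Passing to the limit preserves the dimension. If there were too many tops in the limit, then the sections
  leading them would be linearly dependent at each point of \<open>X\<close>; the normalised relation has a nonzero limit
  and contradicts the independence of polynomials with different tops. If there were too few, then each \<open>Y x\<close>
  would contain a nonzero element without monomials in the set of tops; normalised, these elements form a
  section whose limit has a top outside that set.
\<close>

theorem card_limit_monomials:
  assumes D: "finite D" "inj_on snd D" and T: "T \<subseteq> D"
    and Y: "\<And>x. x \<in> X \<Longrightarrow> kvec.subspace (Y x)"
      "\<And>x f. x \<in> X \<Longrightarrow> f \<in> Y x \<Longrightarrow> Poly_Mapping.keys f \<subseteq> D"
      "\<And>x. x \<in> X \<Longrightarrow> has_tops (Y x) T"
  shows "limit_monomials Y \<subseteq> D" and "card (limit_monomials Y) = card T"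
proof -
  let ?L = "limit_monomials Y"
  have outside: "coeff_fun s m \<in> P" if "\<And>x. x \<in> X \<Longrightarrow> s x \<in> Y x" "m \<notin> D" for s m
  proof (rule vanishing)
    fix x assume "x \<in> X"
    then have "m \<notin> Poly_Mapping.keys (s x)"
      using that Y(2) by blast
    then show "coeff_fun s m x = 0"
      by (simp add: in_keys_iff)
  qed
  show LD: "?L \<subseteq> D"
  proof
    fix Q assume "Q \<in> ?L"
    then obtain s where "\<forall>x\<in>X. s x \<in> Y x" "leads s Q"
      by (rule limit_monomialsE)
    then show "Q \<in> D"
      using outside[of s Q] unfolding leads_def by blast
  qed
  have finL: "finite ?L" and finT: "finite T"
    using finite_subset LD T D(1) by auto
  have "\<not> card T < card ?L"
  proof
    assume less: "card T < card ?L"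
    have "\<forall>Q\<in>?L. \<exists>s. (\<forall>x\<in>X. s x \<in> Y x) \<and> leads s Q"
      unfolding limit_monomials_def by blast
    then obtain s where "\<forall>Q\<in>?L. (\<forall>x\<in>X. s Q x \<in> Y x) \<and> leads (s Q) Q"
      using bchoice by metis
    then have s: "\<And>Q x. Q \<in> ?L \<Longrightarrow> x \<in> X \<Longrightarrow> s Q x \<in> Y x" "\<And>Q. Q \<in> ?L \<Longrightarrow> leads (s Q) Q"
      by blast+
    have "\<exists>c. (\<exists>Q\<in>?L. c Q \<noteq> 0) \<and> (\<Sum>Q\<in>?L. scale (c Q) (s Q x)) = 0" if "x \<in> X" for x
      by (rule ex_nontrivial_relation[OF Y(1)[OF that] Y(3)[OF that] finT finL less]) (rule s(1)[OF _ that])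
    then obtain c where c: "\<And>x. x \<in> X \<Longrightarrow> \<exists>Q\<in>?L. c x Q \<noteq> 0"
        "\<And>x. x \<in> X \<Longrightarrow> (\<Sum>Q\<in>?L. scale (c x Q) (s Q x)) = 0"
      by metis
    obtain h where h: "\<And>Q. Q \<in> ?L \<Longrightarrow> h * (\<lambda>x. c x Q) \<in> V" "\<exists>Q\<in>?L. h * (\<lambda>x. c x Q) \<notin> P"
      using ex_normalising_factor[OF finL, of "\<lambda>Q x. c x Q"] c(1) by blast
    let ?u = "\<lambda>Q. h * (\<lambda>x. c x Q)"
    let ?S = "{Q \<in> ?L. ?u Q \<notin> P}"
    have "finite ?S" "?S \<noteq> {}"
      using finL h(2) by auto
    then obtain Q0 where Q0: "Q0 \<in> ?S" "\<And>Q. Q \<in> ?S \<Longrightarrow> snd Q \<le> snd Q0"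
      using obtains_MAX[of ?S snd] by (metis (no_types, lifting) Max_ge finite_imageI imageI)
    have all: "(\<Sum>Q\<in>?L. ?u Q * coeff_fun (s Q) Q0) \<in> P"
    proof (rule vanishing)
      fix x assume "x \<in> X"
      then have "h x * Poly_Mapping.lookup (\<Sum>Q\<in>?L. scale (c x Q) (s Q x)) Q0 = 0"
        using c(2) by simp
      then show "(\<Sum>Q\<in>?L. ?u Q * coeff_fun (s Q) Q0) x = 0"
        by (simp add: sum_fun_apply lookup_sum sum_distrib_left mult.assoc)
    qed
    have rest: "(\<Sum>Q\<in>?L-{Q0}. ?u Q * coeff_fun (s Q) Q0) \<in> P"
    proof (rule sum_P)
      fix Q assume Q: "Q \<in> ?L - {Q0}"
      show "?u Q * coeff_fun (s Q) Q0 \<in> P"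
      proof (cases "?u Q \<in> P")
        case True
        then show ?thesis
          using mult_P' s(2) Q unfolding leads_def by blast
      next
        case False
        then have "snd Q \<le> snd Q0" "snd Q \<noteq> snd Q0"
          using Q0 Q LD inj_onD[OF D(2), of Q Q0] by auto
        then have "coeff_fun (s Q) Q0 \<in> P"
          using s(2)[of Q] Q unfolding leads_def by (metis DiffD1 le_neq_implies_less)
        then show ?thesis
          using mult_P h(1) Q by blast
      qed
    qed
    have "(\<Sum>Q\<in>?L. ?u Q * coeff_fun (s Q) Q0) =
        ?u Q0 * coeff_fun (s Q0) Q0 + (\<Sum>Q\<in>?L-{Q0}. ?u Q * coeff_fun (s Q) Q0)"
      using Q0(1) by (intro sum.remove finL) blast
    then have "?u Q0 * coeff_fun (s Q0) Q0 \<in> P"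
      using diff_P[OF all rest] by simp
    then show False
      using prime[of "?u Q0" "coeff_fun (s Q0) Q0"] h(1)[of Q0] Q0(1) s(2)[of Q0]
      unfolding leads_def by blast
  qed
  moreover have "\<not> card ?L < card T"
  proof
    assume less: "card ?L < card T"
    have "\<exists>w. w \<in> Y x \<and> w \<noteq> 0 \<and> (\<forall>m\<in>?L. Poly_Mapping.lookup w m = 0)" if "x \<in> X" for x
      using ex_nonzero_vanishing[OF Y(1)[OF that] Y(3)[OF that] inj_on_subset[OF D(2) T] finT finL less]
      by blast
    then obtain w where w: "\<And>x. x \<in> X \<Longrightarrow> w x \<in> Y x" "\<And>x. x \<in> X \<Longrightarrow> w x \<noteq> 0"
        "\<And>x m. x \<in> X \<Longrightarrow> m \<in> ?L \<Longrightarrow> Poly_Mapping.lookup (w x) m = 0"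
      by metis
    have "\<exists>m\<in>D. coeff_fun w m x \<noteq> 0" if xX: "x \<in> X" for x
    proof -
      obtain m where "Poly_Mapping.lookup (w x) m \<noteq> 0"
        using w(2)[OF xX] by (metis poly_mapping_eqI lookup_zero)
      moreover from this have "m \<in> D"
        using Y(2)[OF xX w(1)[OF xX]] by (auto simp: in_keys_iff)
      ultimately show ?thesis by blast
    qed
    then obtain h where h: "\<And>m. m \<in> D \<Longrightarrow> h * coeff_fun w m \<in> V" "\<exists>m\<in>D. h * coeff_fun w m \<notin> P"
      using ex_normalising_factor[OF D(1), of "coeff_fun w"] by blast
    define s where "s x = scale (h x) (w x)" for x
    have s: "s x \<in> Y x" if "x \<in> X" for x
      unfolding s_def using kvec.subspace_scale[OF Y(1)[OF that]] w(1)[OF that] by blast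
    have cs: "coeff_fun s m = h * coeff_fun w m" for m
      by (auto simp: s_def)
    let ?S = "{m \<in> D. coeff_fun s m \<notin> P}"
    have "finite ?S" "?S \<noteq> {}"
      using D(1) h(2) cs by auto
    then obtain Q where Q: "Q \<in> ?S" "\<And>m. m \<in> ?S \<Longrightarrow> snd m \<le> snd Q"
      using obtains_MAX[of ?S snd] by (metis (no_types, lifting) Max_ge finite_imageI imageI)
    have "leads s Q"
      unfolding leads_def
    proof (intro conjI allI impI)
      show "coeff_fun s m \<in> V" for m
        using outside[of s m] s h(1)[of m] P_subset_V cs[of m] by (cases "m \<in> D") auto
      show "coeff_fun s Q \<notin> P"
        using Q(1) by blast
      show "coeff_fun s m \<in> P" if "snd Q < snd m" for m
        using outside[of s m] s Q(2)[of m] that by (cases "m \<in> D") auto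
    qed
    with s have "Q \<in> ?L"
      by (rule limit_monomialsI)
    then have "coeff_fun s Q \<in> P"
      using w(3) by (intro vanishing) (simp add: s_def)
    with Q(1) show False by blast
  qed
  ultimately show "card ?L = card T" by simp
qed

end

section \<open>Weights and homogeneous components\<close>

lemma wdeg_add [simp]: "wdeg a b (m + q) = wdeg a b m + wdeg a b q"
  by (cases m; cases q) (simp add: algebra_simps)

text \<open>
  The monomials of weight \<open>n\<close> lie on a line of direction \<open>(a, b)\<close>.
\<close>

definition line :: "int \<Rightarrow> int \<Rightarrow> int \<Rightarrow> monomial set"
  where "line a b n = {m. wdeg a b m = n}"

lemma wdeg_snd_inj: "b \<noteq> 0 \<Longrightarrow> wdeg a b m = wdeg a b m' \<Longrightarrow> snd m = snd m' \<Longrightarrow> m = m'"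
  by (cases m; cases m') simp

lemma inj_on_snd_line: "b \<noteq> 0 \<Longrightarrow> inj_on snd (line a b n)"
  unfolding line_def by (rule inj_onI) (auto dest: wdeg_snd_inj)

text \<open>
  For \<open>b < 0\<close> both exponents have a positive weight.
\<close>

lemma finite_line:
  assumes "a > 0" "b < 0"
  shows "finite (line a b n)"
proof (rule finite_subset)
  show "line a b n \<subseteq> {..nat n} \<times> {..nat n}"
  proof
    fix m assume "m \<in> line a b n"
    then obtain x y where m: "m = (x, y)" and n: "- b * int x + a * int y = n"
      by (cases m) (auto simp: line_def)
    have "1 * int x \<le> - b * int x" "1 * int y \<le> a * int y"
      by (intro mult_right_mono; use assms in simp)+
    then have "int x \<le> - b * int x" "int y \<le> a * int y"
      by simp_all
    moreover have "0 \<le> int x" "0 \<le> int y"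
      by simp_all
    ultimately have "int x \<le> n" "int y \<le> n"
      using n by linarith+
    then show "m \<in> {..nat n} \<times> {..nat n}"
      by (auto simp: m)
  qed
qed simp

lemma wdeg_eq_imp_multiple:
  assumes "coprime a b" "a > 0" "wdeg a b (x, y) = wdeg a b (x', y')"
  shows "\<exists>l. int x' - int x = l * a \<and> int y' - int y = l * b"
proof -
  have eq: "b * (int x' - int x) = a * (int y' - int y)"
    using assms(3) by (simp add: algebra_simps)
  then have "a dvd (int x' - int x) * b"
    by (metis dvd_triv_left mult.commute)
  then have "a dvd int x' - int x"
    using assms(1) coprime_dvd_mult_left_iff by blast
  then obtain l where l: "int x' - int x = l * a"
    by (metis dvdE mult.commute)
  with eq have "a * (int y' - int y) = a * (l * b)"
    by (simp add: algebra_simps)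
  then show ?thesis
    using l assms(2) by auto
qed

text \<open>
  The component of weight \<open>n\<close>.
\<close>

definition hcomp :: "int \<Rightarrow> int \<Rightarrow> int \<Rightarrow> 'k::field bipoly \<Rightarrow> 'k bipoly"
  where "hcomp a b n = Poly_Mapping.mapp (\<lambda>m c. c when wdeg a b m = n)"

lemma lookup_hcomp:
  "Poly_Mapping.lookup (hcomp a b n f) m = (Poly_Mapping.lookup f m when wdeg a b m = n)"
  by (auto simp: hcomp_def lookup_mapp when_def in_keys_iff)

lemma keys_hcomp: "Poly_Mapping.keys (hcomp a b n f) = Poly_Mapping.keys f \<inter> line a b n"
  by (auto simp: in_keys_iff lookup_hcomp line_def)

definition homogeneous :: "int \<Rightarrow> int \<Rightarrow> 'k::field bipoly set \<Rightarrow> bool"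
  where "homogeneous a b I \<longleftrightarrow> (\<forall>f\<in>I. \<forall>n. hcomp a b n f \<in> I)"

text \<open>
  If every nonzero \<open>t\<close> satisfied \<open>t\<^sup>d = 1\<close>, then \<open>t\<^sup>d\<^sup>+\<^sup>1 - t + 1\<close> would be 1 everywhere and thus have no root.
\<close>

lemma ex_power_neq_one:
  assumes "d > 0"
  shows "\<exists>t::'k::alg_closed_field. t \<noteq> 0 \<and> t ^ d \<noteq> 1"
proof (rule ccontr)
  assume "\<not> ?thesis"
  then have t: "t * t ^ d = t" for t :: 'k
    by (cases "t = 0") auto
  let ?p = "monom (1::'k) (Suc d) + [:1, - 1:]"
  have "degree ?p = Suc d"
    using assms by (subst degree_add_eq_left) (auto simp: degree_monom_eq)
  then obtain x where "poly ?p x = 0"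
    using alg_closed_imp_poly_has_root[of ?p] by auto
  then show False
    using t[of x] by (simp add: poly_monom)
qed

lemma ex_power_int_neq:
  assumes "i \<noteq> j"
  shows "\<exists>t::'k::alg_closed_field. t \<noteq> 0 \<and> t powi i \<noteq> t powi j"
proof -
  have *: "\<exists>t::'k. t \<noteq> 0 \<and> t powi i \<noteq> t powi j" if ij: "i < j" for i j
  proof -
    obtain t :: 'k where t: "t \<noteq> 0" "t ^ nat (j - i) \<noteq> 1"
      using ex_power_neq_one[of "nat (j - i)"] ij by auto
    have "t powi j = t powi i * t powi (j - i)"
      using t(1) by (simp flip: power_int_add)
    also have "t powi (j - i) = t ^ nat (j - i)"
      using ij by (simp add: power_int_def)
    finally show ?thesis
      using t by (intro exI[of _ t]) auto
  qed
  show ?thesis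
    using *[of i j] *[of j i] assms by (metis linorder_neqE)
qed

lemma lookup_torus_act:
  assumes "t \<noteq> 0"
  shows "Poly_Mapping.lookup (torus_act (t powi (- b)) (t powi a) f) m =
    t powi wdeg a b m * Poly_Mapping.lookup f m"
proof (cases m)
  case (Pair x y)
  have "(t powi (- b)) ^ x * (t powi a) ^ y = t powi (- b * int x + a * int y)"
    using assms by (simp add: power_int_add power_int_mult del: mult_minus_left)
  then show ?thesis
    by (auto simp: Pair torus_act_def lookup_mapp when_def in_keys_iff)
qed

text \<open>
  The components of \<open>f\<close> are eigenvectors of the torus for different characters: subtracting a multiple of \<open>f\<close>
  from its translate can be made to kill one component while it multiplies the component of weight \<open>n\<close> by
  a nonzero constant.
\<close>

lemma Hilb_inv_homogeneous:
  fixes I :: "'k::alg_closed_field bipoly set"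
  assumes I: "I \<in> Hilb_inv a b"
  shows "homogeneous a b I"
proof -
  have sub: "kvec.subspace I"
    using I by (intro ideal_imp_kvec_subspace) (simp add: Hilb_inv_def Hilb_def)
  have act: "torus_act (t powi (- b)) (t powi a) f \<in> I" if "t \<noteq> 0" "f \<in> I" for t f
    using I that unfolding Hilb_inv_def by blast
  have "hcomp a b n f \<in> I" if "f \<in> I" for n f
    using that
  proof (induction "card (wdeg a b ` Poly_Mapping.keys f)" arbitrary: f rule: less_induct)
    case less
    show ?case
    proof (cases "Poly_Mapping.keys f \<subseteq> line a b n")
      case True
      then have "hcomp a b n f = f"
        by (intro poly_mapping_eqI) (auto simp: lookup_hcomp when_def in_keys_iff line_def)
      then show ?thesis
        using less.prems by simp
    next
      case False
      then obtain m where m: "m \<in> Poly_Mapping.keys f" "wdeg a b m \<noteq> n"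
        by (auto simp: line_def)
      obtain t :: 'k where t: "t \<noteq> 0" "t powi n \<noteq> t powi wdeg a b m"
        using ex_power_int_neq[of n "wdeg a b m"] m(2) by auto
      define g where "g = torus_act (t powi (- b)) (t powi a) f - scale (t powi wdeg a b m) f"
      have g: "Poly_Mapping.lookup g q = (t powi wdeg a b q - t powi wdeg a b m) * Poly_Mapping.lookup f q" for q
        by (simp add: g_def lookup_minus lookup_torus_act[OF t(1)] left_diff_distrib)
      have "g \<in> I"
        unfolding g_def using act[OF t(1) less.prems] kvec.subspace_scale[OF sub less.prems]
        by (rule kvec.subspace_diff[OF sub])
      have "wdeg a b ` Poly_Mapping.keys g \<subseteq> wdeg a b ` Poly_Mapping.keys f - {wdeg a b m}"
        using g by (auto simp: in_keys_iff)
      moreover have "card (wdeg a b ` Poly_Mapping.keys f - {wdeg a b m}) < card (wdeg a b ` Poly_Mapping.keys f)"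
        using m(1) by (intro card_Diff1_less) auto
      ultimately have "card (wdeg a b ` Poly_Mapping.keys g) < card (wdeg a b ` Poly_Mapping.keys f)"
        by (meson card_mono finite_Diff finite_imageI finite_keys le_less_trans)
      from less.hyps[OF this \<open>g \<in> I\<close>] have "hcomp a b n g \<in> I" .
      then have "scale (inverse (t powi n - t powi wdeg a b m)) (hcomp a b n g) \<in> I"
        by (rule kvec.subspace_scale[OF sub])
      moreover have "scale (inverse (t powi n - t powi wdeg a b m)) (hcomp a b n g) = hcomp a b n f"
        using t(2) by (intro poly_mapping_eqI) (simp add: lookup_hcomp g when_def)
      ultimately show ?thesis by simp
    qed
  qed
  then show ?thesis
    unfolding homogeneous_def by blast
qed

section \<open>Ideals in a Schubert cell\<close>

lemma keys_monomial_ideal: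
  assumes "f \<in> pmod.span (mon ` S)" "k \<in> Poly_Mapping.keys (f :: 'k::field bipoly)"
  shows "\<exists>s\<in>S. \<exists>q. k = s + q"
proof -
  let ?J = "{f :: 'k bipoly. \<forall>k\<in>Poly_Mapping.keys f. \<exists>s\<in>S. \<exists>q. k = s + q}"
  have "pmod.subspace ?J"
  proof (rule pmod.subspaceI)
    show "0 \<in> ?J" by simp
    show "f + g \<in> ?J" if "f \<in> ?J" "g \<in> ?J" for f g
      using that keys_add[of f g] by blast
    show "c * f \<in> ?J" if f: "f \<in> ?J" for c f
    proof (intro CollectI ballI)
      fix k assume "k \<in> Poly_Mapping.keys (c * f)"
      then obtain l q where "k = l + q" "q \<in> Poly_Mapping.keys f"
        using keys_mult[of c f] by blast
      moreover from f this(2) obtain s r where "s \<in> S" "q = s + r" by blast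
      ultimately have "k = s + (l + r)" by (simp add: ac_simps)
      with \<open>s \<in> S\<close> show "\<exists>s\<in>S. \<exists>q. k = s + q" by blast
    qed
  qed
  moreover have "mon ` S \<subseteq> ?J"
    by (auto intro!: bexI exI[of _ 0])
  ultimately have "pmod.span (mon ` S) \<subseteq> ?J"
    by (intro pmod.span_minimal)
  with assms show ?thesis by blast
qed

lemma mon_in_staircase_ideal_iff:
  assumes "staircase E"
  shows "(mon m :: 'k::field bipoly) \<in> staircase_ideal E \<longleftrightarrow> m \<notin> E"
proof
  assume "(mon m :: 'k bipoly) \<in> staircase_ideal E"
  then obtain s q where "s \<in> - E" "m = s + q"
    using keys_monomial_ideal[of "mon m :: 'k bipoly" "- E" m] unfolding staircase_ideal_def by auto
  then show "m \<notin> E"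
    using assms unfolding staircase_def by blast
qed (auto simp: staircase_ideal_def intro: pmod.span_base)

lemma mon_less_asym: "mon_less a b m m' \<Longrightarrow> \<not> mon_less a b m' m"
  by (auto simp: mon_less_def)

lemma initial_monI:
  assumes "m \<in> Poly_Mapping.keys f"
    and "\<And>m'. m' \<in> Poly_Mapping.keys f \<Longrightarrow> m' \<noteq> m \<Longrightarrow> mon_less a b m' m"
  shows "initial_mon a b f = m"
  unfolding initial_mon_def
proof (rule the_equality)
  show "m \<in> Poly_Mapping.keys f \<and> (\<forall>m'\<in>Poly_Mapping.keys f. m' \<noteq> m \<longrightarrow> mon_less a b m' m)"
    using assms by blast
  fix q assume "q \<in> Poly_Mapping.keys f \<and> (\<forall>m'\<in>Poly_Mapping.keys f. m' \<noteq> q \<longrightarrow> mon_less a b m' q)"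
  then show "q = m"
    using assms mon_less_asym by metis
qed

lemma initial_mon_homogeneous:
  assumes "b \<noteq> 0" "Poly_Mapping.keys f \<subseteq> line a b n" "is_top f t"
  shows "initial_mon a b f = t"
proof (rule initial_monI)
  show "t \<in> Poly_Mapping.keys f"
    using assms(3) by (simp add: is_top_def)
  fix m assume m: "m \<in> Poly_Mapping.keys f" "m \<noteq> t"
  then have "wdeg a b m = wdeg a b t" "snd m \<le> snd t"
    using assms(2,3) \<open>t \<in> Poly_Mapping.keys f\<close> by (auto simp: is_top_def line_def)
  then show "mon_less a b m t"
    using wdeg_snd_inj[OF assms(1)] m(2) unfolding mon_less_def by fastforce
qed

text \<open>
  The order compares weights first, so that the initial monomial belongs to the component of largest weight.
\<close>

lemma initial_mon_is_top:
  assumes "b \<noteq> 0" "f \<noteq> (0 :: 'k::field bipoly)"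
  shows "is_top (hcomp a b (wdeg a b (initial_mon a b f)) f) (initial_mon a b f)"
proof -
  have "finite (Poly_Mapping.keys f)" "Poly_Mapping.keys f \<noteq> {}"
    using ex_key[OF assms(2)] by auto
  then obtain q where q: "q \<in> Poly_Mapping.keys f" "Max (wdeg a b ` Poly_Mapping.keys f) = wdeg a b q"
    by (rule obtains_MAX)
  then have wmax: "wdeg a b m \<le> wdeg a b q" if "m \<in> Poly_Mapping.keys f" for m
    using that by (metis Max_ge finite_imageI finite_keys imageI)
  let ?g = "hcomp a b (wdeg a b q) f"
  have "q \<in> Poly_Mapping.keys ?g"
    using q(1) by (simp add: keys_hcomp line_def)
  then have "?g \<noteq> 0" by force
  then obtain t where t: "is_top ?g t"
    using ex_top by blast
  then have tk: "t \<in> Poly_Mapping.keys f" "wdeg a b t = wdeg a b q"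
    by (auto simp: is_top_def keys_hcomp line_def)
  have "initial_mon a b f = t"
  proof (rule initial_monI[OF tk(1)])
    fix m assume m: "m \<in> Poly_Mapping.keys f" "m \<noteq> t"
    show "mon_less a b m t"
    proof (cases "wdeg a b m = wdeg a b t")
      case True
      then have "snd m \<le> snd t"
        using t m(1) tk(2) by (auto simp: is_top_def keys_hcomp line_def)
      then show ?thesis
        using True wdeg_snd_inj[OF assms(1) True] m(2) unfolding mon_less_def by fastforce
    next
      case False
      then show ?thesis
        using wmax[OF m(1)] tk(2) by (simp add: mon_less_def)
    qed
  qed
  with t tk(2) show ?thesis by simp
qed

definition homog_part :: "int \<Rightarrow> int \<Rightarrow> int \<Rightarrow> 'k::field bipoly set \<Rightarrow> 'k bipoly set"
  where "homog_part a b n I = {f \<in> I. Poly_Mapping.keys f \<subseteq> line a b n}"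

lemma is_top_mon_mult: "is_top (mon q * f) (q + t) \<longleftrightarrow> is_top f t"
  unfolding is_top_def keys_mon_mult by auto

text \<open>
  The condition on the initial ideal, expressed on each line. A monomial of the initial ideal
  is a multiple of the initial monomial of some element, and homogeneity allows replacing that element by a
  component.
\<close>

lemma schubert_cell_has_tops:
  fixes I :: "'k::alg_closed_field bipoly set"
  assumes b: "b \<noteq> 0" and E: "staircase E" and I: "I \<in> schubert_cell a b E"
  shows "has_tops (homog_part a b n I) (line a b n - E)"
  unfolding has_tops_def
proof (intro conjI ballI impI)
  have hom: "homogeneous a b I" and sub: "pmod.subspace I"
    and init: "initial_ideal a b I = staircase_ideal E"
    using I Hilb_inv_homogeneous[of I a b]
    by (auto simp: schubert_cell_def Hilb_H_def Hilb_inv_def Hilb_def)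
  show "\<exists>t\<in>line a b n - E. is_top f t" if f: "f \<in> homog_part a b n I" "f \<noteq> 0" for f
  proof -
    obtain t where t: "is_top f t"
      using ex_top f(2) by blast
    have "initial_mon a b f = t"
      using initial_mon_homogeneous[OF b _ t] f(1) by (auto simp: homog_part_def)
    then have "mon t \<in> {mon (initial_mon a b f) | f. f \<in> I \<and> f \<noteq> 0}"
      using f by (auto simp: homog_part_def)
    then have "(mon t :: 'k bipoly) \<in> staircase_ideal E"
      unfolding init[symmetric] initial_ideal_def by (rule pmod.span_base)
    then have "t \<notin> E"
      by (simp add: mon_in_staircase_ideal_iff[OF E])
    with t f(1) show ?thesis
      by (auto simp: homog_part_def is_top_def)
  qed
  show "\<exists>f\<in>homog_part a b n I. is_top f m" if m: "m \<in> line a b n - E" for m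
  proof -
    let ?S = "{initial_mon a b f | f. f \<in> I \<and> f \<noteq> 0}"
    have "{mon (initial_mon a b f) :: 'k bipoly | f. f \<in> I \<and> f \<noteq> 0} = mon ` ?S"
      by auto
    moreover have "(mon m :: 'k bipoly) \<in> initial_ideal a b I"
      using m by (simp add: init mon_in_staircase_ideal_iff[OF E])
    ultimately have m_in: "(mon m :: 'k bipoly) \<in> pmod.span (mon ` ?S)"
      by (simp add: initial_ideal_def)
    have "m \<in> Poly_Mapping.keys (mon m :: 'k bipoly)"
      by simp
    from keys_monomial_ideal[OF m_in this] obtain s q where s: "s \<in> ?S" "m = s + q"
      by blast
    then obtain f where f: "f \<in> I" "f \<noteq> 0" "s = initial_mon a b f"
      by blast
    let ?g = "hcomp a b (wdeg a b s) f"
    have "?g \<in> I"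
      using hom f(1) by (simp add: homogeneous_def)
    then have "mon q * ?g \<in> I"
      by (rule pmod.subspace_scale[OF sub])
    moreover have "is_top (mon q * ?g) m"
      using initial_mon_is_top[OF b f(2), of a] f(3) s(2) is_top_mon_mult[of q ?g s]
      by (simp add: add.commute)
    moreover have "Poly_Mapping.keys (mon q * ?g) \<subseteq> line a b n"
      using m s(2) by (auto simp: keys_mon_mult keys_hcomp line_def)
    ultimately show ?thesis
      unfolding homog_part_def by blast
  qed
qed

section \<open>Charts around a Schubert cell\<close>

lemma Hilb_inv_subspace:
  assumes "I \<in> Hilb_inv a b"
  shows "pmod.subspace I" "kvec.subspace I"
  using assms ideal_imp_kvec_subspace by (auto simp: Hilb_inv_def Hilb_def)

lemma schubert_cell_Hilb_inv: "I \<in> schubert_cell a b E \<Longrightarrow> I \<in> Hilb_inv a b"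
  by (simp add: schubert_cell_def Hilb_H_def)

lemma hcomp_in_homog_part: "homogeneous a b I \<Longrightarrow> f \<in> I \<Longrightarrow> hcomp a b n f \<in> homog_part a b n I"
  by (auto simp: homogeneous_def homog_part_def keys_hcomp)

lemma cell_no_standard_poly:
  fixes I :: "'k::alg_closed_field bipoly set"
  assumes "b \<noteq> 0" "staircase F" "I \<in> schubert_cell a b F"
    and "f \<in> I" "Poly_Mapping.keys f \<subseteq> F"
  shows "f = 0"
proof (rule ccontr)
  assume "f \<noteq> 0"
  then obtain m where m: "m \<in> Poly_Mapping.keys f"
    using ex_key by blast
  let ?g = "hcomp a b (wdeg a b m) f"
  have g: "?g \<in> homog_part a b (wdeg a b m) I"
    using hcomp_in_homog_part Hilb_inv_homogeneous schubert_cell_Hilb_inv assms(3,4) by blast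
  have "m \<in> Poly_Mapping.keys ?g"
    using m by (simp add: keys_hcomp line_def)
  then have "?g \<noteq> 0" by force
  then obtain t where "t \<in> Poly_Mapping.keys ?g" "t \<notin> F"
    using schubert_cell_has_tops[OF assms(1-3)] g unfolding has_tops_def is_top_def by blast
  then show False
    using assms(5) by (auto simp: keys_hcomp)
qed

text \<open>
  The standard monomials of \<open>I\<close> are a basis of the quotient: each other monomial is the top of an element of
  \<open>I\<close> and so is congruent to a combination of monomials of the same weight with smaller second exponent.
\<close>

lemma schubert_cell_subset_chart:
  fixes I :: "'k::alg_closed_field bipoly set"
  assumes b: "b \<noteq> 0" and F: "staircase F" and I: "I \<in> schubert_cell a b F"
  shows "I \<in> chart F"
proof -
  have sub: "kvec.subspace I"
    using Hilb_inv_subspace schubert_cell_Hilb_inv I by blast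
  let ?W = "kvec.span (mon ` F \<union> I)"
  have "mon m \<in> ?W" for m
  proof (induction "snd m" arbitrary: m rule: less_induct)
    case less
    show ?case
    proof (cases "m \<in> F")
      case True
      then show ?thesis by (intro kvec.span_base) simp
    next
      case False
      then have "m \<in> line a b (wdeg a b m) - F"
        by (simp add: line_def)
      moreover have "has_tops (homog_part a b (wdeg a b m) I) (line a b (wdeg a b m) - F)"
        by (rule schubert_cell_has_tops[OF assms])
      ultimately obtain f where f: "f \<in> homog_part a b (wdeg a b m) I" "is_top f m"
        unfolding has_tops_def by blast
      let ?K = "Poly_Mapping.keys f" and ?c = "Poly_Mapping.lookup f"
      have m: "m \<in> ?K" "?c m \<noteq> 0"
        using f(2) by (auto simp: is_top_def in_keys_iff)
      have "mon q \<in> ?W" if q: "q \<in> ?K - {m}" for q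
      proof (rule less)
        have "wdeg a b q = wdeg a b m"
          using f(1) q by (auto simp: homog_part_def line_def)
        then have "snd q \<noteq> snd m"
          using wdeg_snd_inj[OF b] q by blast
        then show "snd q < snd m"
          using f(2) q by (auto simp: is_top_def le_neq_implies_less)
      qed
      then have rest: "(\<Sum>q\<in>?K-{m}. scale (?c q) (mon q)) \<in> ?W"
        by (intro kvec.span_sum kvec.span_scale) blast
      have "f = scale (?c m) (mon m) + (\<Sum>q\<in>?K-{m}. scale (?c q) (mon q))"
        using bipoly_sum_mon[of f] sum.remove[OF finite_keys m(1), of "\<lambda>q. scale (?c q) (mon q)"] by simp
      then have eq: "scale (?c m) (mon m) = f - (\<Sum>q\<in>?K-{m}. scale (?c q) (mon q))"
        by (simp add: algebra_simps)
      have "f \<in> ?W"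
        using f(1) by (intro kvec.span_base) (simp add: homog_part_def)
      then have "scale (?c m) (mon m) \<in> ?W"
        unfolding eq using rest by (rule kvec.span_diff)
      then have "scale (inverse (?c m)) (scale (?c m) (mon m)) \<in> ?W"
        by (rule kvec.span_scale)
      then show ?thesis
        using m(2) by simp
    qed
  qed
  then have "range mon \<subseteq> ?W" by blast
  then have "UNIV \<subseteq> ?W"
    using kvec.span_minimal[OF _ kvec.subspace_span] span_mon_UNIV by metis
  moreover have "kvec.span (mon ` F) \<inter> I = {0}"
    using cell_no_standard_poly[OF assms] kvec.subspace_0[OF sub] by (auto simp: kvec_span_mon)
  moreover have "I \<in> Hilb"
    using schubert_cell_Hilb_inv[OF I] by (simp add: Hilb_inv_def)
  ultimately show ?thesis
    using independent_mon by (simp add: chart_def basis_mod_def)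
qed

text \<open>
  On the chart, \<open>r\<close> is the normal form of \<open>m\<close>, and the coordinates of the chart are its coefficients.
\<close>

lemma chart_reduction:
  fixes I :: "'k::field bipoly set"
  assumes "I \<in> chart B"
  obtains r where "Poly_Mapping.keys r \<subseteq> B" "mon m - r \<in> I"
    "\<And>q. Poly_Mapping.lookup r q = coord B m q I"
proof -
  have sub: "kvec.subspace I"
    using assms by (intro ideal_imp_kvec_subspace) (simp add: chart_def Hilb_def)
  have basis: "UNIV \<subseteq> kvec.span (mon ` B \<union> I)" and zero: "kvec.span (mon ` B) \<inter> I = {0}"
    using assms by (auto simp: chart_def basis_mod_def)
  have "mon m \<in> kvec.span (mon ` B \<union> I)"
    using basis by blast
  then obtain r g where r: "mon m = r + g" "r \<in> kvec.span (mon ` B)" "g \<in> kvec.span I"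
    unfolding kvec.span_Un by blast
  have "g \<in> I"
    using r(3) sub by (metis kvec.span_eq_iff)
  then have rP: "Poly_Mapping.keys r \<subseteq> B \<and> mon m - r \<in> I"
    using r(1,2) by (simp add: kvec_span_mon)
  have "r' = r" if r': "Poly_Mapping.keys r' \<subseteq> B \<and> mon m - r' \<in> I" for r'
  proof -
    have "r' \<in> kvec.span (mon ` B)"
      using r' by (simp add: kvec_span_mon)
    then have "r' - r \<in> kvec.span (mon ` B)"
      using r(2) by (rule kvec.span_diff)
    moreover have "(mon m - r) - (mon m - r') \<in> I"
      using rP r' kvec.subspace_diff[OF sub] by blast
    then have "r' - r \<in> I" by simp
    ultimately have "r' - r \<in> kvec.span (mon ` B) \<inter> I" by blast
    then show ?thesis
      unfolding zero by simp
  qed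
  with rP have the: "(THE r. Poly_Mapping.keys r \<subseteq> B \<and> mon m - r \<in> I) = r"
    by (rule the_equality)
  show ?thesis
  proof (rule that)
    show "Poly_Mapping.keys r \<subseteq> B" "mon m - r \<in> I"
      using rP by simp_all
    show "Poly_Mapping.lookup r q = coord B m q I" for q
      unfolding coord_def the ..
  qed
qed

text \<open>
  Distinguished open sets of the chart are neighbourhoods of \<open>I0\<close>.
\<close>

lemma closure_meets_chart:
  fixes I0 :: "'k::alg_closed_field bipoly set"
  assumes "I0 \<in> schubert_closure a b E" "I0 \<in> chart F" "\<phi> \<in> coord_ring F" "\<phi> I0 \<noteq> 0"
  shows "\<exists>I \<in> schubert_cell a b E \<inter> chart F. \<phi> I \<noteq> 0"
proof -
  let ?H = "Hilb_H a b (hilbert_fun a b (staircase_ideal E :: 'k bipoly set))"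
  let ?U = "{I \<in> chart F. \<phi> I \<noteq> 0}"
  have "openin hilb_topology ?U"
    unfolding hilb_topology_def by (rule topology_generated_by_Basis) (use assms(3) in blast)
  then have U: "openin (subtopology hilb_topology ?H) (?U \<inter> ?H)"
    by (rule openin_subtopology_Int)
  have I0: "I0 \<in> ?U \<inter> ?H"
    using assms unfolding schubert_closure_def in_closure_of by auto
  have "\<forall>T. I0 \<in> T \<and> openin (subtopology hilb_topology ?H) T \<longrightarrow>
      (\<exists>I. I \<in> schubert_cell a b E \<and> I \<in> T)"
    using assms(1) unfolding schubert_closure_def in_closure_of by (rule conjunct2)
  from this[rule_format, OF conjI[OF I0 U]] show ?thesis by blast
qed

text \<open>
  The regular functions of the chart, restricted to the points of the cell, with the ideal of those that
  vanish at \<open>I0\<close>. This ideal is proper precisely because \<open>I0\<close> lies in the closure of the cell: a function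
  that is 1 on the cell and 0 at \<open>I0\<close> would give a neighbourhood of \<open>I0\<close> that avoids the cell.
\<close>

lemma ex_limit_place:
  fixes I0 :: "'k::alg_closed_field bipoly set"
  assumes I0: "I0 \<in> schubert_closure a b E" "I0 \<in> chart F"
  shows "\<exists>V P. limit_place V P (schubert_cell a b E \<inter> chart F) \<and>
    coord_ring F \<subseteq> V \<and> {\<phi> \<in> coord_ring F. \<phi> I0 = 0} \<subseteq> P"
proof -
  let ?X = "schubert_cell a b E \<inter> chart F :: 'k bipoly set set"
  define A where "A = {f. \<exists>\<phi>\<in>coord_ring F. \<forall>I\<in>?X. f I = \<phi> I}"
  define M where "M = {f. \<exists>\<phi>\<in>coord_ring F. \<phi> I0 = 0 \<and> (\<forall>I\<in>?X. f I = \<phi> I)}"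
  have AI: "f \<in> A" if "\<phi> \<in> coord_ring F" "\<And>I. I \<in> ?X \<Longrightarrow> f I = \<phi> I" for f \<phi>
    unfolding A_def using that by blast
  have MI: "f \<in> M" if "\<phi> \<in> coord_ring F" "\<phi> I0 = 0" "\<And>I. I \<in> ?X \<Longrightarrow> f I = \<phi> I" for f \<phi>
    unfolding M_def using that by blast
  have AE: "\<exists>\<phi>\<in>coord_ring F. \<forall>I\<in>?X. f I = \<phi> I" if "f \<in> A" for f
    using that unfolding A_def by blast
  have ME: "\<exists>\<phi>\<in>coord_ring F. \<phi> I0 = 0 \<and> (\<forall>I\<in>?X. f I = \<phi> I)" if "f \<in> M" for f
    using that unfolding M_def by blast
  have "ring_with_ideal A M"
  proof
    show "1 \<in> A"
      by (rule AI[OF coord_ring.const[of 1]]) simp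
    show "f + g \<in> A" if fg: "f \<in> A" "g \<in> A" for f g
    proof -
      obtain \<phi> \<psi> where "\<phi> \<in> coord_ring F" "\<psi> \<in> coord_ring F"
          "\<forall>I\<in>?X. f I = \<phi> I" "\<forall>I\<in>?X. g I = \<psi> I"
        using AE[OF fg(1)] AE[OF fg(2)] by blast
      then show ?thesis
        by (intro AI[OF coord_ring.add[of \<phi> F \<psi>]]) auto
    qed
    show mult: "f * g \<in> A" if fg: "f \<in> A" "g \<in> A" for f g
    proof -
      obtain \<phi> \<psi> where "\<phi> \<in> coord_ring F" "\<psi> \<in> coord_ring F"
          "\<forall>I\<in>?X. f I = \<phi> I" "\<forall>I\<in>?X. g I = \<psi> I"
        using AE[OF fg(1)] AE[OF fg(2)] by blast
      then show ?thesis
        by (intro AI[OF coord_ring.mult[of \<phi> F \<psi>]]) auto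
    qed
    have "- 1 \<in> A"
      by (rule AI[OF coord_ring.const[of "- 1"]]) simp
    from mult[OF this] show "- f \<in> A" if "f \<in> A" for f
      using that by simp
    show "M \<subseteq> A"
      unfolding M_def A_def by blast
    show "0 \<in> M"
      by (rule MI[OF coord_ring.const[of 0]]) simp_all
    show "f + g \<in> M" if fg: "f \<in> M" "g \<in> M" for f g
    proof -
      obtain \<phi> \<psi> where "\<phi> \<in> coord_ring F" "\<psi> \<in> coord_ring F" "\<phi> I0 = 0" "\<psi> I0 = 0"
          "\<forall>I\<in>?X. f I = \<phi> I" "\<forall>I\<in>?X. g I = \<psi> I"
        using ME[OF fg(1)] ME[OF fg(2)] by blast
      then show ?thesis
        by (intro MI[OF coord_ring.add[of \<phi> F \<psi>]]) auto
    qed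
    show "f * g \<in> M" if fg: "f \<in> A" "g \<in> M" for f g
    proof -
      obtain \<phi> \<psi> where "\<phi> \<in> coord_ring F" "\<psi> \<in> coord_ring F" "\<psi> I0 = 0"
          "\<forall>I\<in>?X. f I = \<phi> I" "\<forall>I\<in>?X. g I = \<psi> I"
        using AE[OF fg(1)] ME[OF fg(2)] by blast
      then show ?thesis
        by (intro MI[OF coord_ring.mult[of \<phi> F \<psi>]]) auto
    qed
    show "1 \<notin> M"
    proof
      assume "1 \<in> M"
      then obtain \<phi> where \<phi>: "\<phi> \<in> coord_ring F" "\<phi> I0 = 0" "\<forall>I\<in>?X. 1 = \<phi> I"
        using ME by fastforce
      have "(\<lambda>I. \<phi> I + (- 1)) \<in> coord_ring F"
        using coord_ring.add[OF \<phi>(1) coord_ring.const[of "- 1"]] .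
      from closure_meets_chart[OF I0 this] \<phi> show False by auto
    qed
  qed
  then obtain V P where VP: "manis_pair V P" "A \<subseteq> V" "M \<subseteq> P"
    using ex_manis_pair by blast
  have "limit_place V P ?X"
  proof (intro limit_place.intro VP(1) limit_place_axioms.intro)
    show "f \<in> P" if "\<And>I. I \<in> ?X \<Longrightarrow> f I = 0" for f
      using MI[OF coord_ring.const[of 0], of f] that VP(3) by auto
  qed
  moreover have "coord_ring F \<subseteq> A"
    unfolding A_def by blast
  moreover have "{\<phi> \<in> coord_ring F. \<phi> I0 = 0} \<subseteq> M"
    unfolding M_def by blast
  ultimately show ?thesis
    using VP by blast
qed

section \<open>Chains of monomial sets and systems of arrows\<close>

text \<open>
  On each line, the sets \<open>L n c\<close> increase with \<open>c\<close>, by exactly one element when the line contains an element of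
  \<open>C\<close> of height \<open>c\<close> and by none otherwise. The element that is new in step \<open>c\<close> is sent to that element of \<open>C\<close>.
\<close>

lemma jump_bijection:
  fixes L :: "int \<Rightarrow> nat \<Rightarrow> monomial set"
  assumes b: "b \<noteq> 0" and fin: "\<And>n. finite (line a b n)"
    and mono: "\<And>n c. L n c \<subseteq> L n (Suc c)"
    and sub: "\<And>n c. L n c \<subseteq> line a b n"
    and card: "\<And>n c. card (L n c) = k n + card {m \<in> line a b n \<inter> C. snd m < c}"
    and S: "\<And>Q. Q \<in> S \<longleftrightarrow> Q \<notin> L (wdeg a b Q) 0 \<and> (\<exists>c. Q \<in> L (wdeg a b Q) c)"
  shows "\<exists>\<phi>. bij_betw \<phi> S C \<and>
    (\<forall>Q\<in>S. wdeg a b (\<phi> Q) = wdeg a b Q \<and> (\<forall>c. Q \<in> L (wdeg a b Q) c \<longleftrightarrow> snd (\<phi> Q) < c))"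
proof -
  let ?C = "\<lambda>n c. {m \<in> line a b n \<inter> C. snd m < c}"
  have finL: "finite (L n c)" for n c
    using finite_subset[OF sub fin] .
  have monoL: "c \<le> c' \<Longrightarrow> L n c \<subseteq> L n c'" for n c c'
    by (rule lift_Suc_mono_le[of "L n"]) (rule mono)
  have C_eq: "?C n (Suc c) = ?C n c \<union> {m \<in> line a b n \<inter> C. snd m = c}" for n c
    by auto
  have step: "card (L n (Suc c) - L n c) = card {m \<in> line a b n \<inter> C. snd m = c}" for n c
  proof -
    have "card (?C n (Suc c)) = card (?C n c) + card {m \<in> line a b n \<inter> C. snd m = c}"
      unfolding C_eq using fin by (intro card_Un_disjoint) auto
    then show ?thesis
      using card_Diff_subset[OF finL mono, of n c] card[of n c] card[of n "Suc c"] by simp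
  qed
  have "\<exists>p. p \<in> C \<and> wdeg a b p = wdeg a b Q \<and> (\<forall>c. Q \<in> L (wdeg a b Q) c \<longleftrightarrow> snd p < c)" if "Q \<in> S" for Q
  proof -
    let ?n = "wdeg a b Q"
    have Q: "Q \<notin> L ?n 0" "\<exists>c. Q \<in> L ?n c"
      using S that by auto
    define d where "d = (LEAST c. Q \<in> L ?n c)"
    have d: "Q \<in> L ?n d" "\<And>c. c < d \<Longrightarrow> Q \<notin> L ?n c"
      unfolding d_def using LeastI_ex[OF Q(2)] not_less_Least by blast+
    then obtain c where c: "d = Suc c"
      using Q(1) by (cases d) auto
    have "Q \<in> L ?n (Suc c) - L ?n c"
      using d c by auto
    then have "card (L ?n (Suc c) - L ?n c) > 0"
      using finL by (auto simp: card_gt_0_iff)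
    then have "{m \<in> line a b ?n \<inter> C. snd m = c} \<noteq> {}"
      unfolding step by (metis card.empty less_irrefl)
    then obtain p where p: "p \<in> line a b ?n" "p \<in> C" "snd p = c"
      by blast
    have "Q \<in> L ?n e \<longleftrightarrow> c < e" for e
      using d(1) d(2)[of e] c monoL[of d e ?n] by (metis Suc_leI leI le_imp_less_Suc subsetD)
    with p show ?thesis
      by (intro exI[of _ p]) (auto simp: line_def)
  qed
  then obtain \<phi> where \<phi>: "\<And>Q. Q \<in> S \<Longrightarrow> \<phi> Q \<in> C" "\<And>Q. Q \<in> S \<Longrightarrow> wdeg a b (\<phi> Q) = wdeg a b Q"
      "\<And>Q c. Q \<in> S \<Longrightarrow> Q \<in> L (wdeg a b Q) c \<longleftrightarrow> snd (\<phi> Q) < c"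
    by metis
  have jump: "Q \<in> L (wdeg a b p) (Suc (snd p)) - L (wdeg a b p) (snd p)" if "Q \<in> S" "\<phi> Q = p" for Q p
    using \<phi>(2)[OF that(1)] \<phi>(3)[OF that(1)] that(2) by auto
  have one: "card (L (wdeg a b p) (Suc (snd p)) - L (wdeg a b p) (snd p)) = 1" if "p \<in> C" for p
  proof -
    have "{m \<in> line a b (wdeg a b p) \<inter> C. snd m = snd p} = {p}"
    proof (intro equalityI subsetI)
      fix m assume "m \<in> {m \<in> line a b (wdeg a b p) \<inter> C. snd m = snd p}"
      then have "wdeg a b m = wdeg a b p" "snd m = snd p"
        unfolding line_def by blast+
      then show "m \<in> {p}"
        using wdeg_snd_inj[OF b] by blast
    qed (use that in \<open>simp add: line_def\<close>)
    then show ?thesis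
      unfolding step by simp
  qed
  have "inj_on \<phi> S"
  proof (rule inj_onI)
    fix Q Q' assume "Q \<in> S" "Q' \<in> S" "\<phi> Q = \<phi> Q'"
    then show "Q = Q'"
      using jump[of Q "\<phi> Q"] jump[of Q' "\<phi> Q"] one[OF \<phi>(1), of Q] by (metis card_1_singletonE singletonD)
  qed
  moreover have "C \<subseteq> \<phi> ` S"
  proof
    fix p assume p: "p \<in> C"
    let ?n = "wdeg a b p"
    obtain Q where Q: "Q \<in> L ?n (Suc (snd p))" "Q \<notin> L ?n (snd p)"
      using one[OF p] by (metis DiffE card_1_singletonE singletonI)
    have n: "wdeg a b Q = ?n"
      using Q(1) sub by (auto simp: line_def)
    have "Q \<in> S"
      using S Q monoL[of 0 "snd p" ?n] n by auto
    moreover have "snd (\<phi> Q) = snd p"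
      using \<phi>(3)[OF \<open>Q \<in> S\<close>] Q n by (metis less_Suc_eq)
    then have "\<phi> Q = p"
      using \<phi>(2)[OF \<open>Q \<in> S\<close>] n wdeg_snd_inj[OF b] by metis
    ultimately show "p \<in> \<phi> ` S" by blast
  qed
  ultimately have "bij_betw \<phi> S C"
    using \<phi>(1) by (auto simp: bij_betw_def)
  with \<phi>(2,3) show ?thesis by blast
qed

text \<open>
  The arrow with end \<open>Q\<close> starts at \<open>\<phi> Q\<close>. Its vector is a multiple of \<open>(a, b)\<close> since the weights agree, and
  its length is measured by the difference of the second exponents, because \<open>b \<noteq> 0\<close>. The last assumption
  says that this difference does not decrease when \<open>Q\<close> is multiplied by \<open>m\<close>.
\<close>

lemma ex_arrow_system:
  assumes cop: "coprime a b" and a: "a > 0" and b: "b < 0" and F: "staircase F"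
    and bij: "bij_betw \<phi> F E"
    and wdeg: "\<And>Q. Q \<in> F \<Longrightarrow> wdeg a b (\<phi> Q) = wdeg a b Q"
    and down: "\<And>Q. Q \<in> F \<Longrightarrow> snd (\<phi> Q) \<le> snd Q"
    and mult: "\<And>Q m. Q \<in> F \<Longrightarrow> m + Q \<in> F \<Longrightarrow> snd (\<phi> (m + Q)) \<le> snd (\<phi> Q) + snd m"
  shows "\<exists>S. arrow_system a b E S \<and> arrow_ends S = F"
proof -
  define e where "e = inv_into F \<phi>"
  have e: "e p \<in> F" "\<phi> (e p) = p" if "p \<in> E" for p
    using bij that unfolding e_def bij_betw_def by (auto simp: inv_into_into f_inv_into_f)
  have e\<phi>: "e (\<phi> Q) = Q" "\<phi> Q \<in> E" if "Q \<in> F" for Q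
    using bij that unfolding e_def bij_betw_def by (auto simp: inv_into_f_f)
  have vec: "\<exists>l\<le>0. arrow_vec a b (p, e p) l \<and> int (snd (e p)) - int (snd p) = l * b" if p: "p \<in> E" for p
  proof -
    obtain x y x' y' where xy: "p = (x, y)" "e p = (x', y')"
      by (metis surj_pair)
    have "wdeg a b (x, y) = wdeg a b (x', y')"
      using wdeg[OF e(1)[OF p]] e(2)[OF p] xy by metis
    from wdeg_eq_imp_multiple[OF cop a this] obtain l
      where l: "int x' - int x = l * a" "int y' - int y = l * b" by blast
    have "y \<le> y'"
      using down[OF e(1)[OF p]] e(2)[OF p] xy by simp
    then have "0 \<le> l * b"
      using l(2) by simp
    then have "l \<le> 0"
      using b by (simp add: zero_le_mult_iff)
    then show ?thesis
      using l xy by auto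
  qed
  let ?S = "{(p, e p) | p. p \<in> E}"
  have shorter: "shorter a b (q, e q) (p, e p)" if p: "p \<in> E" and q: "q \<in> E"
      and le: "snd (e q) + snd p \<le> snd (e p) + snd q" for p q
  proof -
    obtain l l' where l: "l \<le> 0" "arrow_vec a b (p, e p) l" "int (snd (e p)) - int (snd p) = l * b"
      and l': "l' \<le> 0" "arrow_vec a b (q, e q) l'" "int (snd (e q)) - int (snd q) = l' * b"
      using vec[OF p] vec[OF q] by blast
    have "l' * b \<le> l * b"
      using le l(3) l'(3) by linarith
    then have "\<bar>l'\<bar> \<le> \<bar>l\<bar>"
      using b l(1) l'(1) by simp
    with l(2) l'(2) show ?thesis
      unfolding shorter_def by blast
  qed
  have divisor: "\<exists>q\<in>E. e q = Q' \<and> snd (e q) + snd p \<le> snd (e p) + snd q"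
    if p: "p \<in> E" and dvd: "mon_dvd Q' (e p)" for p Q'
  proof -
    obtain m where m: "e p = m + Q'"
      using dvd by (auto simp: mon_dvd_def add.commute)
    have Q': "Q' \<in> F"
      using F e(1)[OF p] m by (metis add.commute staircase_def)
    have "snd p \<le> snd (\<phi> Q') + snd m"
      using mult[OF Q', of m] e[OF p] m by simp
    then show ?thesis
      using e\<phi>[OF Q'] m by (intro bexI[of _ "\<phi> Q'"]) auto
  qed
  have "\<forall>f\<in>?S. \<forall>Q'. mon_dvd Q' (snd f) \<longrightarrow> (\<exists>g\<in>?S. snd g = Q' \<and> shorter a b g f)"
  proof (intro ballI allI impI)
    fix f Q' assume "f \<in> ?S" and dvd: "mon_dvd Q' (snd f)"
    then obtain p where p: "f = (p, e p)" "p \<in> E" by blast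
    with dvd divisor[of p Q'] obtain q
      where q: "q \<in> E" "e q = Q'" "snd (e q) + snd p \<le> snd (e p) + snd q" by auto
    have "snd (q, e q) = Q' \<and> shorter a b (q, e q) f"
      using q(2) p(1) shorter[OF p(2) q(1,3)] by simp
    then show "\<exists>g\<in>?S. snd g = Q' \<and> shorter a b g f"
      using q(1) by blast
  qed
  moreover have "\<forall>p\<in>E. is_arrow a b E (p, e p)"
    unfolding is_arrow_def using vec by (metis fst_conv)
  moreover have "inj_on e E"
    using e(2) by (metis inj_onI)
  ultimately have "arrow_system a b E ?S"
    unfolding arrow_system_def by blast
  moreover have "arrow_ends ?S = F"
    unfolding arrow_ends_def
  proof (intro equalityI subsetI)
    fix Q assume "Q \<in> F"
    then have "\<phi> Q \<in> E" "Q = e (\<phi> Q)"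
      using e\<phi> by simp_all
    then have "(\<phi> Q, Q) \<in> ?S" "Q = snd (\<phi> Q, Q)"
      by (blast, simp)
    then show "Q \<in> snd ` ?S"
      by (rule rev_image_eqI)
  qed (use e(1) in auto)
  ultimately show ?thesis by blast
qed

lemma ex_identity_arrow_system:
  assumes "staircase E"
  shows "\<exists>S. arrow_system a b E S \<and> arrow_ends S = E"
proof -
  let ?S = "{(p, p) | p. p \<in> E}"
  have zero: "arrow_vec a b (p, p) 0" for p
    by (cases p) simp
  have "\<forall>f\<in>?S. \<forall>Q'. mon_dvd Q' (snd f) \<longrightarrow> (\<exists>g\<in>?S. snd g = Q' \<and> shorter a b g f)"
  proof (intro ballI allI impI)
    fix f Q' assume f: "f \<in> ?S" "mon_dvd Q' (snd f)"
    then obtain p where p: "f = (p, p)" "p \<in> E" by blast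
    then obtain m where "p = Q' + m"
      using f(2) by (auto simp: mon_dvd_def)
    then have "Q' \<in> E"
      using p(2) assms unfolding staircase_def by blast
    moreover have "shorter a b (Q', Q') f"
      unfolding shorter_def p(1) using zero by blast
    moreover have "snd (Q', Q') = Q'"
      by simp
    ultimately show "\<exists>g\<in>?S. snd g = Q' \<and> shorter a b g f"
      by blast
  qed
  moreover have "\<forall>p\<in>E. is_arrow a b E (p, p)"
    unfolding is_arrow_def using zero by (metis fst_conv order_refl)
  ultimately have "arrow_system a b E ?S"
    unfolding arrow_system_def by (intro conjI exI[of _ "\<lambda>p. p"]) auto
  moreover have "arrow_ends ?S = E"
    by (force simp: arrow_ends_def)
  ultimately show ?thesis by blast
qed

section \<open>The two filtrations attached to an ideal\<close>

text \<open>
  A power of \<open>x\<close> is the smallest monomial of its weight, so it lies in \<open>I\<close> as soon as it is the top of an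
  element of \<open>I\<close>.
\<close>

lemma cell_x_power:
  fixes I :: "'k::alg_closed_field bipoly set"
  assumes b: "b \<noteq> 0" and E: "staircase E" and I: "I \<in> schubert_cell a b E"
    and M: "(M, 0) \<notin> E" "M \<le> fst Q"
  shows "mon Q \<in> I"
proof -
  have "has_tops (homog_part a b (wdeg a b (M, 0)) I) (line a b (wdeg a b (M, 0)) - E)"
    by (rule schubert_cell_has_tops[OF b E I])
  moreover have "(M, 0) \<in> line a b (wdeg a b (M, 0)) - E"
    using M(1) unfolding line_def by blast
  ultimately obtain f where f: "f \<in> homog_part a b (wdeg a b (M, 0)) I" "is_top f (M, 0)"
    unfolding has_tops_def by blast
  have "m = (M, 0)" if m: "m \<in> Poly_Mapping.keys f" for m
  proof (rule wdeg_snd_inj[OF b])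
    show "wdeg a b m = wdeg a b (M, 0)"
      using f(1) m unfolding homog_part_def line_def by blast
    show "snd m = snd (M, 0 :: nat)"
      using f(2) m unfolding is_top_def by auto
  qed
  then have "Poly_Mapping.keys f = {(M, 0)}"
    using f(2) unfolding is_top_def by blast
  moreover have sub: "pmod.subspace I" "kvec.subspace I"
    using Hilb_inv_subspace[OF schubert_cell_Hilb_inv[OF I]] .
  ultimately have "mon (M, 0) \<in> I"
    using f(1) scale_mon_mem[of I f "(M, 0)"] by (simp add: homog_part_def)
  then have "mon (fst Q - M, snd Q) * mon (M, 0) \<in> I"
    by (rule pmod.subspace_scale[OF sub(1)])
  moreover have "(fst Q - M, snd Q) + (M, 0) = Q"
    using M(2) by (cases Q) simp
  ultimately show ?thesis
    by (simp add: mult_single)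
qed

text \<open>
  For a homogeneous ideal, the parts of weight \<open>n\<close> of \<open>I + R\<close> and of \<open>I \<inter> R\<close> (\<open>sum_part\<close> and \<open>low_part\<close>), where \<open>R\<close> is spanned by the
  monomials whose second exponent is less than \<open>c\<close>.
\<close>

definition sum_part :: "int \<Rightarrow> int \<Rightarrow> int \<Rightarrow> nat \<Rightarrow> 'k::field bipoly set \<Rightarrow> 'k bipoly set"
  where "sum_part a b n c I =
    {f + g | f g. f \<in> homog_part a b n I \<and> Poly_Mapping.keys g \<subseteq> {m \<in> line a b n. snd m < c}}"

definition low_part :: "int \<Rightarrow> int \<Rightarrow> int \<Rightarrow> nat \<Rightarrow> 'k::field bipoly set \<Rightarrow> 'k bipoly set"
  where "low_part a b n c I = {f \<in> I. Poly_Mapping.keys f \<subseteq> {m \<in> line a b n. snd m < c}}"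

lemma subspace_homog_part: "kvec.subspace I \<Longrightarrow> kvec.subspace (homog_part a b n I)"
  unfolding homog_part_def using kvec.subspace_inter[OF _ subspace_keys] by (simp add: Int_def)

lemma subspace_low_part: "kvec.subspace I \<Longrightarrow> kvec.subspace (low_part a b n c I)"
  unfolding low_part_def using kvec.subspace_inter[OF _ subspace_keys] by (simp add: Int_def)

lemma subspace_sum_part: "kvec.subspace I \<Longrightarrow> kvec.subspace (sum_part a b n c I)"
  unfolding sum_part_def
  using kvec.subspace_sums[OF subspace_homog_part subspace_keys, of I a b n "{m \<in> line a b n. snd m < c}"]
  unfolding mem_Collect_eq .

lemma sum_part_zero: "sum_part a b n 0 (I :: 'k::field bipoly set) = homog_part a b n I"
proof -
  have "Poly_Mapping.keys g \<subseteq> {m \<in> line a b n. snd m < 0} \<longleftrightarrow> g = 0" for g :: "'k bipoly"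
    using ex_key[of g] by auto
  then show ?thesis
    by (simp add: sum_part_def)
qed

lemma keys_sum_part:
  assumes "f \<in> sum_part a b n c I"
  shows "Poly_Mapping.keys f \<subseteq> line a b n"
proof -
  obtain g h where "f = g + h" "Poly_Mapping.keys g \<subseteq> line a b n"
      "Poly_Mapping.keys h \<subseteq> {m \<in> line a b n. snd m < c}"
    using assms unfolding sum_part_def homog_part_def by blast
  then show ?thesis
    using Poly_Mapping.keys_add[of g h] by blast
qed

lemma mon_mult_homog_part:
  assumes "pmod.subspace I" "f \<in> homog_part a b n I"
  shows "mon m * f \<in> homog_part a b (n + wdeg a b m) I"
proof -
  have "mon m * f \<in> I"
    using assms by (intro pmod.subspace_scale) (auto simp: homog_part_def)
  moreover have "Poly_Mapping.keys (mon m * f) \<subseteq> line a b (n + wdeg a b m)"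
    using assms(2) by (auto simp: homog_part_def keys_mon_mult line_def simp del: wdeg.simps)
  ultimately show ?thesis
    by (simp add: homog_part_def)
qed

lemma keys_mon_mult_below:
  assumes "Poly_Mapping.keys f \<subseteq> {m \<in> line a b n. snd m < c}"
  shows "Poly_Mapping.keys (mon q * f :: 'k::field bipoly) \<subseteq> {m \<in> line a b (n + wdeg a b q). snd m < c + snd q}"
proof
  fix k assume "k \<in> Poly_Mapping.keys (mon q * f)"
  then obtain m where "k = q + m" "m \<in> Poly_Mapping.keys f"
    by (auto simp: keys_mon_mult)
  moreover from this(2) have "wdeg a b m = n" "snd m < c"
    using assms unfolding line_def by blast+
  ultimately show "k \<in> {m \<in> line a b (n + wdeg a b q). snd m < c + snd q}"
    by (simp add: line_def)
qed

lemma mon_mult_low_part: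
  assumes "pmod.subspace I" "f \<in> low_part a b n c I"
  shows "mon m * f \<in> low_part a b (n + wdeg a b m) (c + snd m) I"
proof -
  have "mon m * f \<in> I"
    using assms by (intro pmod.subspace_scale) (auto simp: low_part_def)
  moreover have "Poly_Mapping.keys f \<subseteq> {m \<in> line a b n. snd m < c}"
    using assms(2) by (simp add: low_part_def)
  ultimately show ?thesis
    unfolding low_part_def using keys_mon_mult_below by blast
qed

lemma mon_mult_sum_part:
  assumes "pmod.subspace I" "f \<in> sum_part a b n c I"
  shows "mon m * f \<in> sum_part a b (n + wdeg a b m) (c + snd m) I"
proof -
  obtain g h where f: "f = g + h" "g \<in> homog_part a b n I"
      "Poly_Mapping.keys h \<subseteq> {m \<in> line a b n. snd m < c}"
    using assms(2) unfolding sum_part_def by blast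
  have "mon m * f = mon m * g + mon m * h"
    unfolding f(1) by (rule distrib_left)
  with mon_mult_homog_part[OF assms(1) f(2)] keys_mon_mult_below[OF f(3)] show ?thesis
    unfolding sum_part_def by blast
qed

lemma has_tops_low_part:
  assumes "has_tops (homog_part a b n I) (line a b n - E)"
  shows "has_tops (low_part a b n c I) {m \<in> line a b n - E. snd m < c}"
  unfolding has_tops_def
proof (intro conjI ballI impI)
  fix t assume t: "t \<in> {m \<in> line a b n - E. snd m < c}"
  then obtain f where "f \<in> homog_part a b n I" "is_top f t"
    using assms unfolding has_tops_def by blast
  moreover from this t have "f \<in> low_part a b n c I"
    by (fastforce simp: is_top_def homog_part_def low_part_def)
  ultimately show "\<exists>f\<in>low_part a b n c I. is_top f t" by blast
next
  fix f assume f: "f \<in> low_part a b n c I" "f \<noteq> 0"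
  then have "f \<in> homog_part a b n I"
    unfolding homog_part_def low_part_def by blast
  then obtain t where "t \<in> line a b n - E" "is_top f t"
    using assms f(2) unfolding has_tops_def by blast
  then show "\<exists>t\<in>{m \<in> line a b n - E. snd m < c}. is_top f t"
    using f(1) unfolding is_top_def low_part_def by blast
qed

text \<open>
  Above height \<open>c\<close> an element of the sum has the same coefficients as its summand from \<open>I\<close>, hence the same top.
\<close>

lemma has_tops_sum_part:
  assumes tops: "has_tops (homog_part a b n I) (line a b n - E)" and sub: "kvec.subspace I"
  shows "has_tops (sum_part a b n c I) ((line a b n - E) \<union> {m \<in> line a b n. snd m < c})"
  unfolding has_tops_def
proof (intro conjI ballI impI)
  fix t assume "t \<in> (line a b n - E) \<union> {m \<in> line a b n. snd m < c}"
  then consider "t \<in> line a b n - E" | "t \<in> line a b n" "snd t < c" by blast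
  then show "\<exists>f\<in>sum_part a b n c I. is_top f t"
  proof cases
    case 1
    then obtain f where f: "f \<in> homog_part a b n I" "is_top f t"
      using tops unfolding has_tops_def by blast
    have "f + 0 \<in> sum_part a b n c I"
      unfolding sum_part_def using f(1) by (intro CollectI exI[of _ f] exI[of _ 0]) simp
    with f(2) show ?thesis by auto
  next
    case 2
    have "0 \<in> homog_part a b n I"
      using subspace_homog_part[OF sub] by (rule kvec.subspace_0)
    with 2 have "0 + mon t \<in> sum_part a b n c I"
      unfolding sum_part_def by (intro CollectI exI[of _ 0] exI[of _ "mon t"]) simp
    then show ?thesis
      by (intro bexI[of _ "mon t"]) (auto simp: is_top_def)
  qed
next
  fix h assume h: "h \<in> sum_part a b n c I" "h \<noteq> 0"
  then obtain f g where fg: "h = f + g" "f \<in> homog_part a b n I"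
      "Poly_Mapping.keys g \<subseteq> {m \<in> line a b n. snd m < c}"
    unfolding sum_part_def by blast
  obtain t where t: "is_top h t"
    using ex_top[OF h(2)] by blast
  then have tl: "t \<in> line a b n"
    using keys_sum_part[OF h(1)] by (auto simp: is_top_def)
  show "\<exists>t\<in>(line a b n - E) \<union> {m \<in> line a b n. snd m < c}. is_top h t"
  proof (cases "snd t < c")
    case True
    with t tl show ?thesis by blast
  next
    case False
    have high: "Poly_Mapping.lookup h m = Poly_Mapping.lookup f m" if "\<not> snd m < c" for m
    proof -
      have "m \<notin> Poly_Mapping.keys g"
        using fg(3) that by blast
      then show ?thesis
        by (simp add: fg(1) lookup_add in_keys_iff)
    qed
    have t_f: "t \<in> Poly_Mapping.keys f"
      using t high[OF False] by (simp add: is_top_def in_keys_iff)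
    have "snd m \<le> snd t" if "m \<in> Poly_Mapping.keys f" for m
    proof (cases "snd m < c")
      case False
      then have "m \<in> Poly_Mapping.keys h"
        using high[OF False] that by (simp add: in_keys_iff)
      then show ?thesis
        using t by (simp add: is_top_def)
    qed (use False in simp)
    with t_f have top: "is_top f t"
      by (simp add: is_top_def)
    have "f \<noteq> 0"
      using t_f by force
    then obtain t' where t': "t' \<in> line a b n - E" "is_top f t'"
      using tops fg(2) unfolding has_tops_def by blast
    show ?thesis
    proof (cases "t' = t")
      case True
      with t t'(1) show ?thesis by blast
    next
      case ne: False
      have "t' \<in> Poly_Mapping.keys f" "snd t' = snd t"
        using top t'(2) by (auto simp: is_top_def intro: antisym)
      then have "is_top h t'"
        using t high[of t'] False by (simp add: is_top_def in_keys_iff)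
      with t'(1) show ?thesis by blast
    qed
  qed
qed

section \<open>Limits of the two filtrations\<close>

text \<open>
  The points of the cell of \<open>E\<close> tend to \<open>I0\<close> in the cell of \<open>F\<close>.
\<close>

locale cell_limit = limit_place V P "schubert_cell a b E \<inter> chart F"
  for V P :: "('k::alg_closed_field bipoly set \<Rightarrow> 'k) set"
    and a b :: int and E F :: "monomial set" +
  fixes I0 :: "'k bipoly set"
  assumes a: "a > 0" and b: "b < 0"
    and E: "staircase E" and F: "staircase F"
    and I0: "I0 \<in> schubert_cell a b F"
    and coord_V: "coord_ring F \<subseteq> V"
    and coord_P: "\<And>\<phi>. \<phi> \<in> coord_ring F \<Longrightarrow> \<phi> I0 = 0 \<Longrightarrow> \<phi> \<in> P"
begin

abbreviation X :: "'k bipoly set set"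
  where "X \<equiv> schubert_cell a b E \<inter> chart F"

lemma b_nz: "b \<noteq> 0"
  using b by simp

lemma X_homogeneous: "I \<in> X \<Longrightarrow> homogeneous a b I"
  using Hilb_inv_homogeneous schubert_cell_Hilb_inv by blast

lemma X_subspace: "I \<in> X \<Longrightarrow> pmod.subspace I" "I \<in> X \<Longrightarrow> kvec.subspace I"
  using Hilb_inv_subspace schubert_cell_Hilb_inv by blast+

lemma X_tops: "I \<in> X \<Longrightarrow> has_tops (homog_part a b n I) (line a b n - E)"
  using schubert_cell_has_tops[OF b_nz E] by blast

lemma fin: "finite (line a b n)"
  by (rule finite_line[OF a b])

lemma card_limit:
  assumes "T \<subseteq> line a b n"
    and "\<And>I. I \<in> X \<Longrightarrow> kvec.subspace (Y I)"
    and "\<And>I f. I \<in> X \<Longrightarrow> f \<in> Y I \<Longrightarrow> Poly_Mapping.keys f \<subseteq> line a b n"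
    and "\<And>I. I \<in> X \<Longrightarrow> has_tops (Y I) T"
  shows "limit_monomials Y \<subseteq> line a b n" "card (limit_monomials Y) = card T"
  by (rule card_limit_monomials[OF fin inj_on_snd_line[OF b_nz] assms]; assumption)+

text \<open>
  The section is the component of weight \<open>n\<close> of \<open>Q\<close> minus its normal form in the chart. Its coefficients are
  coordinates of the chart, so they are finite. Those above \<open>Q\<close> tend to their values at \<open>I0\<close>, which are 0: at
  \<open>I0\<close> the only monomial outside \<open>F\<close> in this polynomial is \<open>Q\<close>, so \<open>Q\<close> is its top.
\<close>

lemma standard_in_limit:
  assumes Q: "Q \<in> line a b n" "Q \<notin> F"
  shows "Q \<in> limit_monomials (homog_part a b n)"
proof (rule limit_monomialsI)
  define r where "r I = (SOME r. Poly_Mapping.keys r \<subseteq> F \<and> mon Q - r \<in> I \<and>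
    (\<forall>q. Poly_Mapping.lookup r q = coord F Q q I))" for I :: "'k bipoly set"
  have r: "Poly_Mapping.keys (r I) \<subseteq> F \<and> mon Q - r I \<in> I \<and>
      (\<forall>q. Poly_Mapping.lookup (r I) q = coord F Q q I)" if "I \<in> chart F" for I
    unfolding r_def by (rule someI_ex) (use chart_reduction[OF that, of Q] in metis)
  define s where "s I = hcomp a b n (mon Q - r I)" for I
  show "s I \<in> homog_part a b n I" if "I \<in> X" for I
    unfolding s_def using hcomp_in_homog_part[OF X_homogeneous[OF that]] r that by blast
  have agree: "f \<in> V" "g \<in> P \<Longrightarrow> f \<in> P" if "g \<in> V" "\<And>I. I \<in> X \<Longrightarrow> f I = g I" for f g
  proof -
    have "f - g \<in> P"
      using that(2) by (intro vanishing) simp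
    then show "f \<in> V" "g \<in> P \<Longrightarrow> f \<in> P"
      using add_V[of "f - g" g] add_P[of "f - g" g] that(1) P_subset_V by auto
  qed
  have const: "(\<lambda>_. c) \<in> V" for c
    using coord_ring.const coord_V by blast
  have lookup_s: "Poly_Mapping.lookup (s I) m =
      (if wdeg a b m = n then (if m = Q then 1 else 0) - (if m \<in> F then coord F Q m I else 0) else 0)"
    if "I \<in> chart F" for I m
  proof -
    have "Poly_Mapping.lookup (r I) m = (if m \<in> F then coord F Q m I else 0)"
      using r[OF that] by (metis in_keys_iff subsetD)
    then show ?thesis
      by (auto simp: s_def lookup_hcomp lookup_minus lookup_single when_def)
  qed
  have minus_coord: "(\<lambda>I. - coord F Q m I) \<in> coord_ring F" if "m \<in> F" for m
    using coord_ring.mult[OF coord_ring.const[of "- 1"] coord_ring.coord[OF that]] by simp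
  have I0_chart: "I0 \<in> chart F"
    by (rule schubert_cell_subset_chart[OF b_nz F I0])
  have I0_coord: "coord F Q m I0 = 0" if m: "m \<in> F" "wdeg a b m = n" "snd Q < snd m" for m
  proof (rule ccontr)
    assume "coord F Q m I0 \<noteq> 0"
    then have m_key: "m \<in> Poly_Mapping.keys (s I0)"
      using lookup_s[OF I0_chart, of m] m Q(2) by (auto simp: in_keys_iff)
    have "s I0 \<in> homog_part a b n I0"
      unfolding s_def using r[OF I0_chart] I0
      by (intro hcomp_in_homog_part Hilb_inv_homogeneous schubert_cell_Hilb_inv) blast+
    moreover have "s I0 \<noteq> 0"
      using m_key by force
    ultimately obtain t where t: "t \<notin> F" "is_top (s I0) t"
      using schubert_cell_has_tops[OF b_nz F I0, of n] unfolding has_tops_def by blast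
    have "t = Q"
      using t lookup_s[OF I0_chart, of t] by (auto simp: is_top_def in_keys_iff split: if_splits)
    then show False
      using t(2) m_key m(3) unfolding is_top_def by fastforce
  qed
  show "leads s Q"
    unfolding leads_def
  proof (intro conjI allI impI)
    show "coeff_fun s Q \<notin> P"
    proof
      assume Q_P: "coeff_fun s Q \<in> P"
      have "1 \<in> P"
      proof (rule agree(2))
        show "coeff_fun s Q \<in> V"
          using Q_P P_subset_V by blast
        show "1 I = coeff_fun s Q I" if "I \<in> X" for I
          using lookup_s[of I Q] that Q by (simp add: line_def)
      qed (rule Q_P)
      then show False
        using one_notin_P by blast
    qed
    show "coeff_fun s m \<in> V" for m
    proof (cases "wdeg a b m = n \<and> m \<noteq> Q \<and> m \<in> F")
      case True
      show ?thesis
      proof (rule agree(1))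
        show "(\<lambda>I. - coord F Q m I) \<in> V"
          using minus_coord[of m] coord_V True by blast
        show "coeff_fun s m I = - coord F Q m I" if "I \<in> X" for I
          using lookup_s[of I m] that True by simp
      qed
    next
      case False
      show ?thesis
      proof (rule agree(1))
        show "(\<lambda>_. if m = Q then 1 else 0) \<in> V"
          by (rule const)
        show "coeff_fun s m I = (if m = Q then 1 else 0)" if "I \<in> X" for I
          using lookup_s[of I m] that False Q by (auto simp: line_def)
      qed
    qed
    show "coeff_fun s m \<in> P" if less: "snd Q < snd m" for m
    proof (cases "wdeg a b m = n \<and> m \<in> F")
      case True
      have P: "(\<lambda>I. - coord F Q m I) \<in> P"
        using coord_P[OF minus_coord] I0_coord less True by simp
      show ?thesis
      proof (rule agree(2))
        show "(\<lambda>I. - coord F Q m I) \<in> V"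
          using P P_subset_V by blast
        show "coeff_fun s m I = - coord F Q m I" if "I \<in> X" for I
          using lookup_s[of I m] that True less by auto
      qed (rule P)
    next
      case False
      show ?thesis
      proof (rule vanishing)
        show "coeff_fun s m I = 0" if "I \<in> X" for I
          using lookup_s[of I m] that False less by auto
      qed
    qed
  qed
qed

text \<open>
  The ideals of the cell tend to \<open>I0\<close>. One inclusion is the previous lemma; equality follows by counting,
  since the monomials in \<open>F\<close> are linearly independent modulo an ideal of the chart and so the complement of \<open>F\<close>
  on the line has at least as many elements as that of \<open>E\<close>.
\<close>

lemma limit_homog_part: "limit_monomials (homog_part a b n) = line a b n - F"
proof -
  let ?L = "limit_monomials (homog_part a b n)"
  have L: "?L \<subseteq> line a b n" "card ?L = card (line a b n - E)"
    using X_tops subspace_homog_part[OF X_subspace(2)]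
    by (intro card_limit[of "line a b n - E"]; auto simp: homog_part_def)+
  obtain I where I: "I \<in> X"
    using vanishing[of 1] one_notin_P by blast
  have "\<not> card (line a b n - F) < card (line a b n - E)"
  proof
    assume less: "card (line a b n - F) < card (line a b n - E)"
    have "\<exists>w\<in>homog_part a b n I. w \<noteq> 0 \<and> (\<forall>m\<in>line a b n - F. Poly_Mapping.lookup w m = 0)"
      using fin by (intro ex_nonzero_vanishing[OF subspace_homog_part[OF X_subspace(2)[OF I]] X_tops[OF I] _ _ _ less])
        (auto intro: inj_on_subset[OF inj_on_snd_line[OF b_nz]])
    then obtain w where w: "w \<in> homog_part a b n I" "w \<noteq> 0"
        "\<And>m. m \<in> line a b n - F \<Longrightarrow> Poly_Mapping.lookup w m = 0" by blast
    have "Poly_Mapping.keys w \<subseteq> F"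
    proof
      fix m assume m: "m \<in> Poly_Mapping.keys w"
      then have "m \<in> line a b n"
        using w(1) by (auto simp: homog_part_def)
      then show "m \<in> F"
        using w(3)[of m] m by (auto simp: in_keys_iff)
    qed
    then have "w \<in> kvec.span (mon ` F) \<inter> I"
      using w(1) by (simp add: kvec_span_mon homog_part_def)
    moreover have "kvec.span (mon ` F) \<inter> I = {0}"
      using I by (simp add: chart_def basis_mod_def)
    ultimately show False
      using w(2) by blast
  qed
  moreover have sub: "line a b n - F \<subseteq> ?L"
    using standard_in_limit by blast
  moreover have "finite ?L"
    using finite_subset[OF L(1) fin] .
  ultimately show ?thesis
    using L(2) card_seteq[OF \<open>finite ?L\<close> sub] by simp
qed

text \<open>
  The spaces \<open>sum_part n c\<close> grow from the part of weight \<open>n\<close> of \<open>I\<close> to the space of all polynomials of that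
  weight, by one dimension for each monomial in \<open>E\<close>. In the limit the tops start with the complement of \<open>F\<close>
  and are joined by the monomials of \<open>F\<close> one at a time.
\<close>

lemma ex_bijection_standard:
  "\<exists>\<phi>. bij_betw \<phi> F E \<and> (\<forall>Q\<in>F. wdeg a b (\<phi> Q) = wdeg a b Q \<and> snd (\<phi> Q) \<le> snd Q) \<and>
    (\<forall>Q\<in>F. \<forall>m. m + Q \<in> F \<longrightarrow> snd (\<phi> (m + Q)) \<le> snd (\<phi> Q) + snd m)"
proof -
  define L where "L n c = limit_monomials (sum_part a b n c)" for n c
  let ?T = "\<lambda>n c. (line a b n - E) \<union> {m \<in> line a b n. snd m < c}"
  have L: "L n c \<subseteq> line a b n" "card (L n c) = card (?T n c)" for n c
    unfolding L_def using X_tops subspace_sum_part[OF X_subspace(2)] keys_sum_part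
    by (intro card_limit[of "?T n c"] has_tops_sum_part[OF X_tops X_subspace(2)]; blast)+
  have card: "card (L n c) = card (line a b n - E) + card {m \<in> line a b n \<inter> E. snd m < c}" for n c
  proof -
    have "?T n c = (line a b n - E) \<union> {m \<in> line a b n \<inter> E. snd m < c}"
      by blast
    then show ?thesis
      unfolding L(2) using fin by (simp add: card_Un_disjoint disjoint_iff)
  qed
  have mono: "L n c \<subseteq> L n (Suc c)" for n c
    unfolding L_def by (rule limit_monomials_mono) (fastforce simp: sum_part_def)
  have L0: "L n 0 = line a b n - F" for n
    unfolding L_def sum_part_zero by (rule limit_homog_part)
  have self: "Q \<in> L (wdeg a b Q) (Suc (snd Q))" for Q
    unfolding L_def
  proof (rule mon_in_limit_monomials)
    fix I assume "I \<in> X"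
    then have "0 \<in> homog_part a b (wdeg a b Q) I"
      using kvec.subspace_0 subspace_homog_part X_subspace(2) by blast
    moreover have "Poly_Mapping.keys (mon Q :: 'k bipoly) \<subseteq> {m \<in> line a b (wdeg a b Q). snd m < Suc (snd Q)}"
      by (simp add: line_def)
    ultimately have "0 + mon Q \<in> sum_part a b (wdeg a b Q) (Suc (snd Q)) I"
      unfolding sum_part_def by blast
    then show "mon Q \<in> sum_part a b (wdeg a b Q) (Suc (snd Q)) I" by simp
  qed
  have S: "Q \<in> F \<longleftrightarrow> Q \<notin> L (wdeg a b Q) 0 \<and> (\<exists>c. Q \<in> L (wdeg a b Q) c)" for Q
    using self[of Q] unfolding L0 by (auto simp: line_def)
  from jump_bijection[OF b_nz fin mono L(1) card S] obtain \<phi>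
    where \<phi>: "bij_betw \<phi> F E" "\<And>Q. Q \<in> F \<Longrightarrow> wdeg a b (\<phi> Q) = wdeg a b Q"
      "\<And>Q c. Q \<in> F \<Longrightarrow> Q \<in> L (wdeg a b Q) c \<longleftrightarrow> snd (\<phi> Q) < c" by blast
  have "snd (\<phi> Q) \<le> snd Q" if "Q \<in> F" for Q
    using \<phi>(3)[OF that, of "Suc (snd Q)"] self[of Q] by simp
  moreover have "snd (\<phi> (m + Q)) \<le> snd (\<phi> Q) + snd m" if Q: "Q \<in> F" "m + Q \<in> F" for Q m
  proof -
    have "Q \<in> L (wdeg a b Q) (Suc (snd (\<phi> Q)))"
      using \<phi>(3)[OF Q(1)] by simp
    then have "m + Q \<in> L (wdeg a b Q + wdeg a b m) (Suc (snd (\<phi> Q)) + snd m)"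
      unfolding L_def by (rule limit_monomials_mult) (rule mon_mult_sum_part[OF X_subspace(1)])
    then show ?thesis
      using \<phi>(3)[OF Q(2), of "Suc (snd (\<phi> Q)) + snd m"] by (simp add: add.commute)
  qed
  ultimately show ?thesis
    using \<phi>(1,2) by (intro exI[of _ \<phi>]) simp
qed

text \<open>
  The same with \<open>low_part n c\<close>, which grows from 0 to the part of weight \<open>n\<close> of \<open>I\<close>, by one dimension for each
  monomial outside \<open>E\<close>; in the limit the tops exhaust the complement of \<open>F\<close>. Heights now go up, since a limit
  of polynomials of height less than \<open>c\<close> has its top below \<open>c\<close>.
\<close>

lemma ex_bijection_complement:
  "\<exists>\<psi>. bij_betw \<psi> (- F) (- E) \<and> (\<forall>Q\<in>-F. wdeg a b (\<psi> Q) = wdeg a b Q \<and> snd Q \<le> snd (\<psi> Q)) \<and>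
    (\<forall>Q\<in>-F. \<forall>m. snd (\<psi> (m + Q)) \<le> snd (\<psi> Q) + snd m) \<and>
    (\<forall>Q\<in>-F. (\<forall>I\<in>X. mon Q \<in> I) \<longrightarrow> \<psi> Q = Q)"
proof -
  define L where "L n c = limit_monomials (low_part a b n c)" for n c
  let ?T = "\<lambda>n c. {m \<in> line a b n - E. snd m < c}"
  have L: "L n c \<subseteq> line a b n" "card (L n c) = card (?T n c)" for n c
    unfolding L_def using subspace_low_part[OF X_subspace(2)]
    by (intro card_limit[of "?T n c"] has_tops_low_part[OF X_tops]; auto simp: low_part_def)+
  have card: "card (L n c) = 0 + card {m \<in> line a b n \<inter> - E. snd m < c}" for n c
    unfolding L(2) by (simp add: Diff_eq)
  have mono: "L n c \<subseteq> L n (Suc c)" for n c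
    unfolding L_def by (rule limit_monomials_mono) (fastforce simp: low_part_def)
  have L0: "L n 0 = {}" for n
    using L(2)[of n 0] finite_subset[OF L(1) fin, of n 0] by simp
  have below: "L n c \<subseteq> line a b n - F" for n c
    unfolding L_def limit_homog_part[symmetric]
    by (rule limit_monomials_mono) (auto simp: low_part_def homog_part_def)
  have top: "\<exists>c. L n c = line a b n - F" for n
  proof -
    obtain c where c: "\<And>m. m \<in> line a b n \<Longrightarrow> snd m < c"
      using finite_nat_set_iff_bounded[of "snd ` line a b n"] fin by blast
    have "low_part a b n c = (homog_part a b n :: 'k bipoly set \<Rightarrow> _)"
      using c unfolding low_part_def homog_part_def by (intro ext) blast
    then have "L n c = line a b n - F"
      unfolding L_def limit_homog_part[symmetric] by simp
    then show ?thesis ..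
  qed
  have S: "Q \<in> - F \<longleftrightarrow> Q \<notin> L (wdeg a b Q) 0 \<and> (\<exists>c. Q \<in> L (wdeg a b Q) c)" for Q
  proof -
    have "Q \<in> line a b (wdeg a b Q)"
      unfolding line_def by blast
    then show ?thesis
      using below top L0 by (metis Compl_iff Diff_iff empty_iff subsetD)
  qed
  from jump_bijection[OF b_nz fin mono L(1) card S] obtain \<psi>
    where \<psi>: "bij_betw \<psi> (- F) (- E)" "\<And>Q. Q \<in> - F \<Longrightarrow> wdeg a b (\<psi> Q) = wdeg a b Q"
      "\<And>Q c. Q \<in> - F \<Longrightarrow> Q \<in> L (wdeg a b Q) c \<longleftrightarrow> snd (\<psi> Q) < c" by blast
  have up: "snd Q \<le> snd (\<psi> Q)" if "Q \<in> - F" for Q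
  proof -
    have "Q \<in> L (wdeg a b Q) (Suc (snd (\<psi> Q)))"
      using \<psi>(3)[OF that] by simp
    then obtain s where s: "\<forall>I\<in>X. s I \<in> low_part a b (wdeg a b Q) (Suc (snd (\<psi> Q))) I" "leads s Q"
      unfolding L_def by (rule limit_monomialsE)
    then have "coeff_fun s Q \<notin> P"
      by (simp add: leads_def)
    then obtain I where I: "I \<in> X" "Poly_Mapping.lookup (s I) Q \<noteq> 0"
      using vanishing[of "coeff_fun s Q"] by auto
    then have "Q \<in> Poly_Mapping.keys (s I)"
      by (simp add: in_keys_iff)
    moreover have "s I \<in> low_part a b (wdeg a b Q) (Suc (snd (\<psi> Q))) I"
      using s(1) I(1) by blast
    ultimately show ?thesis
      unfolding low_part_def by auto
  qed
  moreover have "snd (\<psi> (m + Q)) \<le> snd (\<psi> Q) + snd m" if Q: "Q \<in> - F" for Q m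
  proof -
    have mQ: "m + Q \<in> - F"
      using Q F unfolding staircase_def by (metis ComplD ComplI add.commute)
    have "Q \<in> L (wdeg a b Q) (Suc (snd (\<psi> Q)))"
      using \<psi>(3)[OF Q] by simp
    then have "m + Q \<in> L (wdeg a b Q + wdeg a b m) (Suc (snd (\<psi> Q)) + snd m)"
      unfolding L_def by (rule limit_monomials_mult) (rule mon_mult_low_part[OF X_subspace(1)])
    then show ?thesis
      using \<psi>(3)[OF mQ, of "Suc (snd (\<psi> Q)) + snd m"] by (simp add: add.commute)
  qed
  moreover have "\<psi> Q = Q" if Q: "Q \<in> - F" "\<forall>I\<in>X. mon Q \<in> I" for Q
  proof -
    have "Q \<in> L (wdeg a b Q) (Suc (snd Q))"
      unfolding L_def
    proof (rule mon_in_limit_monomials)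
      show "mon Q \<in> low_part a b (wdeg a b Q) (Suc (snd Q)) I" if "I \<in> X" for I
        using Q(2) that by (simp add: low_part_def line_def)
    qed
    then have "snd (\<psi> Q) = snd Q"
      using \<psi>(3)[OF Q(1)] up[OF Q(1)] by simp
    then show ?thesis
      using \<psi>(2)[OF Q(1)] wdeg_snd_inj[OF b_nz] by metis
  qed
  ultimately show ?thesis
    using \<psi>(1,2) by (intro exI[of _ \<psi>]) simp
qed

end

section \<open>The case of positive slope\<close>

text \<open>
  For \<open>b > 0\<close> both exponents grow along a line, so every monomial far enough on the line lies in \<open>I\<close>. Moving
  the smallest monomial of \<open>f\<close> to a given place of the line by multiplication, all other terms of the product
  lie further out and hence in \<open>I\<close> by induction, and so the monomial at that place lies in \<open>I\<close>.
\<close>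

lemma positive_slope_monomial:
  fixes I :: "'k::alg_closed_field bipoly set"
  assumes cop: "coprime a b" and a: "a > 0" and b: "b > 0"
    and sub: "pmod.subspace I" and x_power: "\<And>q. M \<le> fst q \<Longrightarrow> mon q \<in> I"
    and f: "f \<in> homog_part a b n I" "m \<in> Poly_Mapping.keys f"
  shows "mon m \<in> I"
proof -
  have ksub: "kvec.subspace I"
    using sub by (rule ideal_imp_kvec_subspace)
  have "finite (Poly_Mapping.keys f)" "Poly_Mapping.keys f \<noteq> {}"
    using f(2) by auto
  then obtain m0 where m0: "m0 \<in> Poly_Mapping.keys f"
      and least: "Min (fst ` Poly_Mapping.keys f) = fst m0"
    by (rule obtains_MIN)
  have least: "fst m0 \<le> fst q" if "q \<in> Poly_Mapping.keys f" for q
    using that least by (metis Min_le finite_imageI finite_keys imageI)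
  have on_line: "wdeg a b q = n" if "q \<in> Poly_Mapping.keys f" for q
    using f(1) that unfolding homog_part_def line_def by blast
  have "mon q \<in> I" if "wdeg a b q = n" "fst m0 \<le> fst q" for q
    using that
  proof (induction "M - fst q" arbitrary: q rule: less_induct)
    case less
    show ?case
    proof (cases "M \<le> fst q")
      case True
      then show ?thesis by (rule x_power)
    next
      case False
      have "wdeg a b (fst m0, snd m0) = wdeg a b (fst q, snd q)"
        using on_line[OF m0] less.prems(1) by simp
      from wdeg_eq_imp_multiple[OF cop a this] obtain l
        where l: "int (fst q) - int (fst m0) = l * a" "int (snd q) - int (snd m0) = l * b" by blast
      have "0 \<le> l * a"
        using less.prems(2) l(1) by linarith
      then have "0 \<le> l"
        using a by (simp add: zero_le_mult_iff)
      then have "0 \<le> l * b"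
        using b by simp
      then have "snd m0 \<le> snd q"
        using l(2) by linarith
      then have q: "q = (fst q - fst m0, snd q - snd m0) + m0"
        using less.prems(2) by (cases q; cases m0) simp
      define d where "d = (fst q - fst m0, snd q - snd m0)"
      let ?g = "mon d * f"
      let ?K = "Poly_Mapping.keys ?g" and ?c = "Poly_Mapping.lookup ?g"
      have qd: "q = d + m0"
        using q d_def by simp
      have "q \<in> ?K"
        unfolding keys_mon_mult qd using m0 by blast
      have "mon r \<in> I" if r: "r \<in> ?K - {q}" for r
      proof -
        obtain k where k: "r = d + k" "k \<in> Poly_Mapping.keys f"
          using r by (auto simp: keys_mon_mult)
        have "wdeg a b k = wdeg a b m0"
          using on_line[OF k(2)] on_line[OF m0] by simp
        have "fst k \<noteq> fst m0"
        proof
          assume "fst k = fst m0"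
          with \<open>wdeg a b k = wdeg a b m0\<close> have "k = m0"
            using a by (cases k; cases m0) simp
          with r k(1) qd show False by blast
        qed
        with least[OF k(2)] have "fst q < fst r"
          unfolding qd k(1) by simp
        moreover have "wdeg a b r = n"
          unfolding k(1) using \<open>wdeg a b k = wdeg a b m0\<close> less.prems(1) qd wdeg_add by metis
        ultimately show ?thesis
          using False less.prems(2) by (intro less.hyps) auto
      qed
      then have rest: "(\<Sum>r\<in>?K-{q}. scale (?c r) (mon r)) \<in> I"
        using kvec.subspace_scale[OF ksub] by (intro kvec.subspace_sum[OF ksub]) blast
      have "?g \<in> I"
        using f(1) by (intro pmod.subspace_scale[OF sub]) (simp add: homog_part_def)
      then have "?g - (\<Sum>r\<in>?K-{q}. scale (?c r) (mon r)) \<in> I"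
        using rest by (rule kvec.subspace_diff[OF ksub])
      moreover have "(\<Sum>r\<in>?K. scale (?c r) (mon r)) = scale (?c q) (mon q) + (\<Sum>r\<in>?K-{q}. scale (?c r) (mon r))"
        by (rule sum.remove[OF finite_keys \<open>q \<in> ?K\<close>])
      then have "?g - (\<Sum>r\<in>?K-{q}. scale (?c r) (mon r)) = scale (?c q) (mon q)"
        unfolding bipoly_sum_mon by (simp only: eq_diff_eq[symmetric] diff_eq_eq)
      ultimately have q_I: "scale (?c q) (mon q) \<in> I"
        by (rule back_subst[where P = "\<lambda>h. h \<in> I"])
      have "?c q \<noteq> 0"
        using \<open>q \<in> ?K\<close> unfolding in_keys_iff .
      then have "Poly_Mapping.keys (scale (?c q) (mon q)) = {q}"
        by (rule keys_scale_mon)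
      from scale_mon_mem[OF ksub this q_I] show ?thesis .
    qed
  qed
  then show ?thesis
    using on_line[OF f(2)] least[OF f(2)] by blast
qed

text \<open>
  The cell of \<open>E\<close> consists of monomial ideals, and a monomial ideal belongs to only one chart.
\<close>

lemma positive_slope_cells_agree:
  fixes I :: "'k::alg_closed_field bipoly set"
  assumes cop: "coprime a b" and a: "a > 0" and b: "b > 0"
    and E: "staircase E" and M: "(M, 0) \<notin> E"
    and I: "I \<in> schubert_cell a b E" "I \<in> chart F"
  shows "E = F"
proof -
  have b_nz: "b \<noteq> 0" using b by simp
  have hom: "homogeneous a b I" and sub: "pmod.subspace I"
    using I(1) Hilb_inv_homogeneous Hilb_inv_subspace schubert_cell_Hilb_inv by blast+
  have mono: "mon m \<in> I" if "f \<in> homog_part a b n I" "m \<in> Poly_Mapping.keys f" for f m n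
    by (rule positive_slope_monomial[OF cop a b sub _ that]) (rule cell_x_power[OF b_nz E I(1) M])
  have iff: "mon m \<in> I \<longleftrightarrow> m \<notin> E" for m
  proof
    have tops: "has_tops (homog_part a b (wdeg a b m) I) (line a b (wdeg a b m) - E)"
      by (rule schubert_cell_has_tops[OF b_nz E I(1)])
    show "mon m \<in> I" if "m \<notin> E"
    proof -
      have "m \<in> line a b (wdeg a b m) - E"
        using that unfolding line_def by blast
      then obtain f where "f \<in> homog_part a b (wdeg a b m) I" "is_top f m"
        using tops unfolding has_tops_def by blast
      then show ?thesis
        using mono unfolding is_top_def by blast
    qed
    show "m \<notin> E" if "mon m \<in> I"
    proof -
      have "mon m \<in> homog_part a b (wdeg a b m) I"
        using that by (simp add: homog_part_def line_def)
      moreover have "(mon m :: 'k bipoly) \<noteq> 0"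
        by (metis keys_single keys_zero insert_not_empty zero_neq_one)
      ultimately obtain t where "t \<in> line a b (wdeg a b m) - E" "is_top (mon m :: 'k bipoly) t"
        using tops unfolding has_tops_def by blast
      then show ?thesis
        unfolding is_top_def by simp
    qed
  qed
  show ?thesis
  proof (intro equalityI subsetI)
    fix m assume m: "m \<in> F"
    have "(mon m :: 'k bipoly) \<in> kvec.span (mon ` F)"
      using m by (intro kvec.span_base) simp
    moreover have "kvec.span (mon ` F) \<inter> I = {0}"
      using I(2) by (simp add: chart_def basis_mod_def)
    moreover have "(mon m :: 'k bipoly) \<noteq> 0"
      by (metis keys_single keys_zero insert_not_empty zero_neq_one)
    ultimately have "mon m \<notin> I" by blast
    then show "m \<in> E" using iff by blast
  next
    fix m assume m: "m \<in> E"
    obtain r where r: "Poly_Mapping.keys r \<subseteq> F" "mon m - r \<in> I"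
      using chart_reduction[OF I(2)] by metis
    show "m \<in> F"
    proof (rule ccontr)
      assume "m \<notin> F"
      then have "m \<notin> Poly_Mapping.keys r" using r(1) by blast
      then have "m \<in> Poly_Mapping.keys (hcomp a b (wdeg a b m) (mon m - r))"
        by (simp add: in_keys_iff lookup_hcomp lookup_minus)
      then have "mon m \<in> I"
        using mono hcomp_in_homog_part[OF hom r(2)] by blast
      with iff m show False by blast
    qed
  qed
qed

section \<open>Duality in the box\<close>

text \<open>
  The point reflection of the box, an involution that turns the complement of a staircase into its dual.
\<close>

definition reflect :: "nat \<Rightarrow> nat \<Rightarrow> monomial \<Rightarrow> monomial"
  where "reflect M N m = (M - 1 - fst m, N - 1 - snd m)"

lemma reflect_box: "m \<in> staircase_box M N \<Longrightarrow> reflect M N m \<in> staircase_box M N"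
  by (auto simp: reflect_def staircase_box_def)

lemma reflect_reflect: "m \<in> staircase_box M N \<Longrightarrow> reflect M N (reflect M N m) = m"
  by (auto simp: reflect_def staircase_box_def)

lemma dual_staircase_eq: "dual_staircase M N E = {m \<in> staircase_box M N. reflect M N m \<notin> E}"
  by (auto simp: dual_staircase_def reflect_def)

lemma bij_betw_reflect: "bij_betw (reflect M N) (dual_staircase M N E) (- E \<inter> staircase_box M N)"
  by (rule bij_betw_byWitness[where f' = "reflect M N"])
    (auto simp: dual_staircase_eq reflect_reflect reflect_box)

lemma reflect_add:
  assumes "m + Q \<in> staircase_box M N"
  shows "reflect M N Q = m + reflect M N (m + Q)"
  using assms by (cases m; cases Q) (auto simp: reflect_def staircase_box_def)

lemma staircase_dual:
  assumes "staircase E"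
  shows "staircase (dual_staircase M N E)"
  unfolding staircase_def
proof (intro allI impI notI)
  fix m q assume m: "m \<notin> dual_staircase M N E" and "m + q \<in> dual_staircase M N E"
  then have box: "q + m \<in> staircase_box M N" and "reflect M N (q + m) \<notin> E"
    by (auto simp: dual_staircase_eq add.commute)
  then have "reflect M N m \<notin> E"
    using assms reflect_add[OF box] unfolding staircase_def by (metis add.commute)
  moreover have "m \<in> staircase_box M N"
    using box by (cases m; cases q) (auto simp: staircase_box_def)
  ultimately show False
    using m by (simp add: dual_staircase_eq)
qed

lemma wdeg_reflect:
  "m \<in> staircase_box M N \<Longrightarrow> wdeg a b (reflect M N m) = wdeg a b (M - 1, N - 1) - wdeg a b m"
  by (cases m) (auto simp: reflect_def staircase_box_def of_nat_diff algebra_simps)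

text \<open>
  An injection that maps the finite complement of the box on each line into itself permutes it, so the rest is
  matched within the box.
\<close>

lemma bij_betw_box:
  assumes bij: "bij_betw \<psi> (- F) (- E)" and out: "- B \<subseteq> - F" "- B \<subseteq> - E"
    and fin: "\<And>n. finite (line a b n)"
    and wdeg: "\<And>Q. Q \<in> - F \<Longrightarrow> wdeg a b (\<psi> Q) = wdeg a b Q"
    and stay: "\<And>Q. Q \<in> - B \<Longrightarrow> \<psi> Q \<in> - B"
  shows "bij_betw \<psi> (- F \<inter> B) (- E \<inter> B)"
proof -
  have inj: "inj_on \<psi> (- F)" and img: "\<psi> ` (- F) = - E"
    using bij by (auto simp: bij_betw_def)
  have "\<psi> ` (line a b n - B) = line a b n - B" for n
  proof (rule endo_inj_surj)
    show "finite (line a b n - B)"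
      using fin by simp
    show "\<psi> ` (line a b n - B) \<subseteq> line a b n - B"
    proof (rule image_subsetI)
      fix Q assume Q: "Q \<in> line a b n - B"
      then have "wdeg a b (\<psi> Q) = n"
        using wdeg[of Q] out(1) unfolding line_def by blast
      then show "\<psi> Q \<in> line a b n - B"
        using stay[of Q] Q unfolding line_def by blast
    qed
    show "inj_on \<psi> (line a b n - B)"
      by (rule inj_on_subset[OF inj]) (use out(1) in blast)
  qed
  moreover have "- B = (\<Union>n. line a b n - B)"
    unfolding line_def by blast
  ultimately have "\<psi> ` (- B) = - B"
    by (metis (no_types, lifting) SUP_cong image_UN)
  then have "\<psi> ` (- F - - B) = - E - - B"
    using inj_on_image_set_diff[OF inj, of "- F" "- B"] img out(1) by auto
  then have "\<psi> ` (- F \<inter> B) = - E \<inter> B"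
    by (simp add: Diff_eq)
  moreover have "inj_on \<psi> (- F \<inter> B)"
    by (rule inj_on_subset[OF inj]) blast
  ultimately show ?thesis
    by (simp add: bij_betw_def)
qed

text \<open>
  Reflection reverses divisibility and heights: a bijection between the complements that raises heights, by
  less and less as monomials are multiplied, becomes one between the duals that lowers heights, by more and
  more as monomials are multiplied.
\<close>

lemma ex_dual_arrow_system:
  assumes cop: "coprime a b" and a: "a > 0" and b: "b < 0" and F: "staircase F"
    and bij: "bij_betw \<psi> (- F \<inter> staircase_box M N) (- E \<inter> staircase_box M N)"
    and wdeg: "\<And>Q. Q \<in> - F \<Longrightarrow> wdeg a b (\<psi> Q) = wdeg a b Q"
    and up: "\<And>Q. Q \<in> - F \<Longrightarrow> snd Q \<le> snd (\<psi> Q)"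
    and mult: "\<And>Q m. Q \<in> - F \<Longrightarrow> snd (\<psi> (m + Q)) \<le> snd (\<psi> Q) + snd m"
  shows "\<exists>S. arrow_system a b (dual_staircase M N E) S \<and> arrow_ends S = dual_staircase M N F"
proof -
  let ?B = "staircase_box M N" and ?\<rho> = "reflect M N"
  let ?\<phi> = "?\<rho> \<circ> (\<psi> \<circ> ?\<rho>)"
  have \<psi>: "\<psi> R \<in> ?B" "\<psi> R \<in> - E" if "R \<in> - F" "R \<in> ?B" for R
    using bij that by (auto simp: bij_betw_def)
  have R: "?\<rho> Q \<in> - F" "?\<rho> Q \<in> ?B" "Q \<in> ?B" "?\<rho> (?\<rho> Q) = Q" if "Q \<in> dual_staircase M N F" for Q
    using that by (auto simp: dual_staircase_eq reflect_box reflect_reflect)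
  have reflect_back: "bij_betw ?\<rho> (- E \<inter> ?B) (dual_staircase M N E)"
    by (rule bij_betw_byWitness[where f' = "?\<rho>"])
      (auto simp: dual_staircase_eq reflect_reflect reflect_box)
  show ?thesis
  proof (rule ex_arrow_system[OF cop a b staircase_dual[OF F]])
    show "bij_betw ?\<phi> (dual_staircase M N F) (dual_staircase M N E)"
      by (intro bij_betw_trans[OF bij_betw_trans[OF bij_betw_reflect bij] reflect_back])
    fix Q assume Q: "Q \<in> dual_staircase M N F"
    show "wdeg a b (?\<phi> Q) = wdeg a b Q"
      using wdeg_reflect[OF \<psi>(1)[OF R(1,2)[OF Q]], of a b] wdeg[OF R(1)[OF Q]]
        wdeg_reflect[OF R(3)[OF Q], of a b] by simp
    show "snd (?\<phi> Q) \<le> snd Q"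
      using up[OF R(1)[OF Q]] R(3)[OF Q] by (auto simp: reflect_def staircase_box_def)
    fix m assume mQ: "m + Q \<in> dual_staircase M N F"
    have "?\<rho> Q = m + ?\<rho> (m + Q)"
      using R(3)[OF mQ] by (rule reflect_add)
    then have "snd (\<psi> (?\<rho> Q)) \<le> snd (\<psi> (?\<rho> (m + Q))) + snd m"
      using mult[OF R(1)[OF mQ], of m] by simp
    then have "N - 1 - snd (\<psi> (?\<rho> (m + Q))) \<le> N - 1 - snd (\<psi> (?\<rho> Q)) + snd m"
      by arith
    then show "snd (?\<phi> (m + Q)) \<le> snd (?\<phi> Q) + snd m"
      unfolding reflect_def[of M N "\<psi> _"] comp_apply snd_conv .
  qed
qed

section \<open>Incidence of Schubert cells\<close>

theorem theorem8:
  fixes a b :: int and M N :: nat and E F :: "monomial set"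
  assumes "coprime a b" and "a > 0" and "b \<noteq> 0"
    and "staircase E" and "staircase F"
    and "E \<subseteq> staircase_box M N" and "F \<subseteq> staircase_box M N"
    and "(schubert_closure a b E :: 'k::alg_closed_field bipoly set set) \<inter> schubert_cell a b F \<noteq> {}"
  shows "(\<exists>S. arrow_system a b E S \<and> arrow_ends S = F) \<and>
    (\<exists>S'. arrow_system a b (dual_staircase M N E) S' \<and> arrow_ends S' = dual_staircase M N F)"
proof -
  obtain I0 :: "'k bipoly set" where I0: "I0 \<in> schubert_closure a b E" "I0 \<in> schubert_cell a b F"
    using assms(8) by blast
  have chart: "I0 \<in> chart F"
    by (rule schubert_cell_subset_chart[OF assms(3,5) I0(2)])
  have M: "(M, 0) \<notin> E"
    using assms(6) by (auto simp: staircase_box_def)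
  show ?thesis
  proof (cases "b > 0")
    case True
    obtain I :: "'k bipoly set" where "I \<in> schubert_cell a b E" "I \<in> chart F"
      using closure_meets_chart[OF I0(1) chart coord_ring.const[of 1]] by auto
    then have "E = F"
      by (rule positive_slope_cells_agree[OF assms(1,2) True assms(4) M])
    then show ?thesis
      using ex_identity_arrow_system assms(5) staircase_dual by blast
  next
    case False
    then have b: "b < 0"
      using assms(3) by simp
    obtain V P where VP: "limit_place V P (schubert_cell a b E \<inter> chart F :: 'k bipoly set set)"
        "coord_ring F \<subseteq> V" "{\<phi> \<in> coord_ring F. \<phi> I0 = 0} \<subseteq> P"
      using ex_limit_place[OF I0(1) chart] by blast
    interpret cell_limit V P a b E F I0
      using VP assms(2,4,5) b I0(2) by (intro cell_limit.intro cell_limit_axioms.intro) auto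
    obtain \<phi> where \<phi>: "bij_betw \<phi> F E" "\<And>Q. Q \<in> F \<Longrightarrow> wdeg a b (\<phi> Q) = wdeg a b Q"
        "\<And>Q. Q \<in> F \<Longrightarrow> snd (\<phi> Q) \<le> snd Q"
        "\<And>Q m. Q \<in> F \<Longrightarrow> m + Q \<in> F \<Longrightarrow> snd (\<phi> (m + Q)) \<le> snd (\<phi> Q) + snd m"
      using ex_bijection_standard by blast
    obtain \<psi> where \<psi>: "bij_betw \<psi> (- F) (- E)" "\<And>Q. Q \<in> - F \<Longrightarrow> wdeg a b (\<psi> Q) = wdeg a b Q"
        "\<And>Q. Q \<in> - F \<Longrightarrow> snd Q \<le> snd (\<psi> Q)"
        "\<And>Q m. Q \<in> - F \<Longrightarrow> snd (\<psi> (m + Q)) \<le> snd (\<psi> Q) + snd m"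
        "\<And>Q. Q \<in> - F \<Longrightarrow> \<forall>I\<in>X. mon Q \<in> I \<Longrightarrow> \<psi> Q = Q"
      using ex_bijection_complement by blast
    \<comment> \<open>To the right of the box nothing moves, because the power of x lies in all ideals of the cell; above the box,
      monomials can only move further up.\<close>
    have "\<psi> Q \<in> - staircase_box M N" if Q: "Q \<in> - staircase_box M N" for Q
    proof -
      have QF: "Q \<in> - F"
        using Q assms(7) by blast
      show ?thesis
      proof (cases "M \<le> fst Q")
        case True
        then have "\<forall>I\<in>X. mon Q \<in> I"
          using cell_x_power[OF assms(3,4) _ M True] by blast
        with \<psi>(5)[OF QF] Q show ?thesis
          by simp
      next
        case False
        then have "N \<le> snd Q"
          using Q by (cases Q) (auto simp: staircase_box_def)
        then have "N \<le> snd (\<psi> Q)"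
          using \<psi>(3)[OF QF] by simp
        then show ?thesis
          by (cases "\<psi> Q") (auto simp: staircase_box_def)
      qed
    qed
    then have "bij_betw \<psi> (- F \<inter> staircase_box M N) (- E \<inter> staircase_box M N)"
      using assms(6,7) by (intro bij_betw_box[OF \<psi>(1) _ _ fin \<psi>(2)]) auto
    from ex_dual_arrow_system[OF assms(1,2) b assms(5) this \<psi>(2,3,4)]
      ex_arrow_system[OF assms(1,2) b assms(5) \<phi>] show ?thesis
      by blast
  qed
qed

end
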